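(* For an integer $d\ge 2$ and a field $\mathbb{K}$, let $H_L(\mathbb{K},d)$ be the minimum of $H_L(\mathbb{K},\mathcal{L})$ over all configurations $\mathcal{L}$ of $d$ lines in $\mathbb{P}^2(\mathbb{K})$, and let $H_L(d)=\min_{\mathbb{K}} H_L(\mathbb{K},d)$, the minimum over all fields $\mathbb{K}$. Then the absolute linear Harbourne constants are $$H_L(2)=0,\ H_L(3)=-1,\ H_L(4)=-\tfrac{4}{3},\ H_L(5)=-\tfrac{3}{2},\ H_L(6)=-\tfrac{12}{7},\ H_L(7)=-2,\ H_L(8)=-2,\ H_L(9)=-\tfrac{9}{4},\ H_L(10)=-\tfrac{29}{12},$$ and over the complex numbers $$H_L(\mathbb{C},2)=0,\ H_L(\mathbb{C},3)=-1,\ H_L(\mathbb{C},4)=-\tfrac{4}{3},\ H_L(\mathbb{C},5)=-\tfrac{3}{2},\ H_L(\mathbb{C},6)=-\tfrac{12}{7},\ H_L(\mathbb{C},7)=-\tfrac{17}{9},\ H_L(\mathbb{C},8)=-2,\ H_L(\mathbb{C},9)=-\tfrac{9}{4},\ H_L(\mathbb{C},10)=-\tfrac{34}{15}.$$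
   Context: A configuration of lines in $\mathbb{P}^2(\mathbb{K})$ is a family $\mathcal{L}=\{L_1,\ldots,L_d\}$ of $d$ mutually distinct lines. Its set of singular points $\mathcal{P}(\mathcal{L})=\{P_1,\ldots,P_s\}$ is the set of points lying on at least two lines of $\mathcal{L}$. For a point $P$, $m_{\mathcal{L}}(P)$ denotes the number of lines of $\mathcal{L}$ passing through $P$. The linear Harbourne constant of $\mathcal{L}$ is $$H_L(\mathbb{K},\mathcal{L})=\frac{d^2-\sum_{k=1}^s m_{\mathcal{L}}(P_k)^2}{s}.$$ *)

theory Defs
  imports "HOL-Algebra.Ring" "HOL-Algebra.Ring" Complex_Main
begin

text \<open>Projective plane P^2(K) over a field K given as a HOL-Algebra structure R.
  Points (and, dually, lines) are classes of nonzero vectors of K^3 up to nonzero scalars.\<close>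

definition nzvec :: "('a, 'b) ring_scheme \<Rightarrow> 'a \<times> 'a \<times> 'a \<Rightarrow> bool" where
  "nzvec R v \<longleftrightarrow> v \<in> carrier R \<times> carrier R \<times> carrier R \<and> v \<noteq> (\<zero>\<^bsub>R\<^esub>, \<zero>\<^bsub>R\<^esub>, \<zero>\<^bsub>R\<^esub>)"

definition smul3 :: "('a, 'b) ring_scheme \<Rightarrow> 'a \<Rightarrow> 'a \<times> 'a \<times> 'a \<Rightarrow> 'a \<times> 'a \<times> 'a" where
  "smul3 R c v = (case v of (x, y, z) \<Rightarrow> (c \<otimes>\<^bsub>R\<^esub> x, c \<otimes>\<^bsub>R\<^esub> y, c \<otimes>\<^bsub>R\<^esub> z))"

definition pclass :: "('a, 'b) ring_scheme \<Rightarrow> 'a \<times> 'a \<times> 'a \<Rightarrow> ('a \<times> 'a \<times> 'a) set" where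
  "pclass R v = {smul3 R c v | c. c \<in> carrier R \<and> c \<noteq> \<zero>\<^bsub>R\<^esub>}"

definition proj_plane :: "('a, 'b) ring_scheme \<Rightarrow> ('a \<times> 'a \<times> 'a) set set" where
  "proj_plane R = {pclass R v | v. nzvec R v}"

definition bil3 :: "('a, 'b) ring_scheme \<Rightarrow> 'a \<times> 'a \<times> 'a \<Rightarrow> 'a \<times> 'a \<times> 'a \<Rightarrow> 'a" where
  "bil3 R u v = (case u of (a, b, c) \<Rightarrow> case v of (x, y, z) \<Rightarrow>
      (a \<otimes>\<^bsub>R\<^esub> x) \<oplus>\<^bsub>R\<^esub> (b \<otimes>\<^bsub>R\<^esub> y) \<oplus>\<^bsub>R\<^esub> (c \<otimes>\<^bsub>R\<^esub> z))"

definition incident :: "('a, 'b) ring_scheme \<Rightarrow> ('a \<times> 'a \<times> 'a) set \<Rightarrow> ('a \<times> 'a \<times> 'a) set \<Rightarrow> bool" where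
  "incident R l P \<longleftrightarrow> (\<exists>u\<in>l. \<exists>v\<in>P. bil3 R u v = \<zero>\<^bsub>R\<^esub>)"

definition line_config :: "('a, 'b) ring_scheme \<Rightarrow> ('a \<times> 'a \<times> 'a) set set \<Rightarrow> nat \<Rightarrow> bool" where
  "line_config R L d \<longleftrightarrow> L \<subseteq> proj_plane R \<and> finite L \<and> card L = d"

definition mult_pt :: "('a, 'b) ring_scheme \<Rightarrow> ('a \<times> 'a \<times> 'a) set set \<Rightarrow> ('a \<times> 'a \<times> 'a) set \<Rightarrow> nat" where
  "mult_pt R L P = card {l \<in> L. incident R l P}"

definition sing_points :: "('a, 'b) ring_scheme \<Rightarrow> ('a \<times> 'a \<times> 'a) set set \<Rightarrow> ('a \<times> 'a \<times> 'a) set set" where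
  "sing_points R L = {P \<in> proj_plane R. 2 \<le> mult_pt R L P}"

definition harbourne_const :: "('a, 'b) ring_scheme \<Rightarrow> ('a \<times> 'a \<times> 'a) set set \<Rightarrow> real" where
  "harbourne_const R L =
     (real (card L) ^ 2 - (\<Sum>P\<in>sing_points R L. real (mult_pt R L P) ^ 2)) / real (card (sing_points R L))"

definition HL_min_is :: "('a, 'b) ring_scheme \<Rightarrow> nat \<Rightarrow> real \<Rightarrow> bool" where
  "HL_min_is R d v \<longleftrightarrow> (\<exists>L. line_config R L d \<and> harbourne_const R L = v) \<and>
                        (\<forall>L. line_config R L d \<longrightarrow> v \<le> harbourne_const R L)"

definition complex_field :: "complex ring" where
  "complex_field = \<lparr>carrier = UNIV, monoid.mult = (*), one = 1, zero = 0, add = (+)\<rparr>"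

definition HL_abs_table :: "(nat \<times> real) list" where
  "HL_abs_table = [(2, 0), (3, -1), (4, -4/3), (5, -3/2), (6, -12/7), (7, -2), (8, -2),
                   (9, -9/4), (10, -29/12)]"

definition HL_C_table :: "(nat \<times> real) list" where
  "HL_C_table = [(2, 0), (3, -1), (4, -4/3), (5, -3/2), (6, -12/7), (7, -17/9), (8, -2),
                 (9, -9/4), (10, -34/15)]"

end

theory Submission
  imports Defs "HOL-Number_Theory.Cong"
begin

text \<open>
  Two lines meet in exactly one point, so the sets of lines through the singular points are the blocks
  of a linear space on \<open>L\<close>: any two elements lie in a unique block. Counting pairs gives
  \<open>d\<^sup>2 - \<Sum> m\<^sup>2 = d - \<Sum> m\<close>, so \<open>H \<ge> - q / p\<close> says \<open>\<Sum> (p m - q) \<le> p d\<close>. For this, fix a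
  large block \<open>A\<close>; every other block meets it at most once, and the weight \<open>p m - q\<close> of a block is
  charged to the pairs it contains, at one rate for pairs joining \<open>A\<close> to its complement and
  another for pairs inside the complement. This gives the bounds over all fields; they are attained in
  the planes over the fields with two and three elements.

  Over the complex numbers it remains to exclude the Fano plane for \<open>d = 7\<close> and three kinds of
  linear spaces for \<open>d = 10\<close>. If three quadruple points lie on a line of \<open>L\<close>, the other nine
  lines form a net that is almost a Latin square, which forces \<open>3 = 0\<close>. Otherwise parity leaves either three
  quadruple points, which is combinatorially impossible, or four of them in general position,
  where coordinates again force \<open>3 = 0\<close>.
\<close>

section \<open>Linear spaces\<close>

text \<open>A single rate for all pairs has to be \<open>p / (d - 1)\<close> per ordered pair. It
  pays for blocks of every size when \<open>d\<close> is at most 5 or equal to 7. For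
  \<open>d = 6, 8, 9, 10\<close> certain blocks weigh more than their own pairs pay, although such
  blocks cannot use up all pairs; fixing one of them as \<open>A\<close> makes this visible. The two
  rates are then chosen so that the charges are exact for the block sizes that matter most, and the
  weights are multiplied by 2, 4 or 6 to keep the rates integral. Where a gap remains, parity closes
  it: a block of three elements takes two neighbours of each of its members, so an element with an
  odd number of neighbours to be covered needs a block of another size.

  Over the complex numbers counting alone cannot suffice, because the planes over the fields with
  two and three elements contain linear spaces with the smaller values -2 and -29/12. The
  characteristic enters only through determinants: each line is a vector, and three lines are
  concurrent iff their determinant vanishes. Dually, elements may be pictured as points and blocks
  as lines; the coordinate arguments use that picture.\<close>

definition off_diag :: "'a set \<Rightarrow> ('a \<times> 'a) set" where
  "off_diag S = S \<times> S - Id"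

lemma card_off_diag:
  assumes "finite S" shows "card (off_diag S) = card S * (card S - 1)"
proof -
  have "off_diag S = S \<times> S - (\<lambda>x. (x, x)) ` S"
    by (auto simp: off_diag_def)
  moreover have "card ((\<lambda>x. (x, x)) ` S) = card S"
    by (rule card_image) (auto simp: inj_on_def)
  ultimately show ?thesis
    using assms by (subst \<open>off_diag S = _\<close>, subst card_Diff_subset)
      (auto simp: card_cartesian_product right_diff_distrib')
qed

section \<open>Double counting of pairs in a linear space\<close>

locale linear_space =
  fixes L :: "'a set" and \<B> :: "'a set set"
  assumes finite_L: "finite L"
    and block_subset: "B \<in> \<B> \<Longrightarrow> B \<subseteq> L"
    and block_card_ge: "B \<in> \<B> \<Longrightarrow> 2 \<le> card B"
    and block_exists: "x \<in> L \<Longrightarrow> y \<in> L \<Longrightarrow> x \<noteq> y \<Longrightarrow> \<exists>B\<in>\<B>. x \<in> B \<and> y \<in> B"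
    and block_unique: "B \<in> \<B> \<Longrightarrow> B' \<in> \<B> \<Longrightarrow> x \<noteq> y \<Longrightarrow> x \<in> B \<Longrightarrow> y \<in> B
      \<Longrightarrow> x \<in> B' \<Longrightarrow> y \<in> B' \<Longrightarrow> B = B'"
begin

lemma finite_blocks: "finite \<B>"
  by (rule finite_subset[of _ "Pow L"]) (auto simp: finite_L dest: block_subset)

lemma finite_block: "B \<in> \<B> \<Longrightarrow> finite B"
  using block_subset finite_L finite_subset by blast

lemma block_card_le: "B \<in> \<B> \<Longrightarrow> card B \<le> card L"
  using block_subset finite_L card_mono by blast

text \<open>Each pair of distinct elements lies in exactly one square \<open>B \<times> B\<close>,
  so the squares partition \<open>S\<close>. The counts of all pairs, of pairs at one element, of
  pairs leaving a set and of pairs outside a set are instances with different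
  \<open>S\<close>.\<close>

lemma count_pairs:
  assumes "S \<subseteq> L \<times> L" "S \<inter> Id = {}"
  shows "(\<Sum>B\<in>\<B>. card (S \<inter> B \<times> B)) = card S"
proof -
  have "S = (\<Union>B\<in>\<B>. S \<inter> B \<times> B)"
  proof (intro equalityI subsetI)
    fix p assume p: "p \<in> S"
    obtain x y where "p = (x, y)" by fastforce
    then show "p \<in> (\<Union>B\<in>\<B>. S \<inter> B \<times> B)"
      using assms p block_exists[of x y] by auto
  qed auto
  moreover have "card (\<Union>B\<in>\<B>. S \<inter> B \<times> B) = (\<Sum>B\<in>\<B>. card (S \<inter> B \<times> B))"
  proof (rule card_UN_disjoint)
    show "\<forall>B\<in>\<B>. \<forall>B'\<in>\<B>. B \<noteq> B' \<longrightarrow> (S \<inter> B \<times> B) \<inter> (S \<inter> B' \<times> B') = {}"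
    proof (intro ballI impI equals0I)
      fix B B' p assume B: "B \<in> \<B>" "B' \<in> \<B>" "B \<noteq> B'" "p \<in> (S \<inter> B \<times> B) \<inter> (S \<inter> B' \<times> B')"
      obtain x y where "p = (x, y)" by fastforce
      then show False
        using assms B block_unique[of B B' x y] by auto
    qed
  qed (auto simp: finite_blocks finite_block)
  ultimately show ?thesis by metis
qed

lemma sum_block_pairs: "(\<Sum>B\<in>\<B>. card B * (card B - 1)) = card L * (card L - 1)"
proof -
  have "off_diag L \<inter> B \<times> B = off_diag B" if "B \<in> \<B>" for B
    using block_subset[OF that] by (auto simp: off_diag_def)
  moreover have "(\<Sum>B\<in>\<B>. card (off_diag L \<inter> B \<times> B)) = card (off_diag L)"
    by (rule count_pairs) (auto simp: off_diag_def)
  ultimately have "(\<Sum>B\<in>\<B>. card (off_diag B)) = card (off_diag L)"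
    by simp
  then show ?thesis
    by (simp add: card_off_diag finite_L finite_block)
qed

lemma sum_star:
  assumes "x \<in> L" shows "(\<Sum>B\<in>{B\<in>\<B>. x \<in> B}. card B - 1) = card L - 1"
proof -
  have "card (({x} \<times> (L - {x})) \<inter> B \<times> B) = (if x \<in> B then card B - 1 else 0)"
    if "B \<in> \<B>" for B
  proof -
    have "({x} \<times> (L - {x})) \<inter> B \<times> B = (if x \<in> B then {x} \<times> (B - {x}) else {})"
      using block_subset[OF that] by auto
    then show ?thesis using finite_block[OF that] by (simp add: card_cartesian_product)
  qed
  then have "(\<Sum>B\<in>\<B>. if x \<in> B then card B - 1 else 0) = card ({x} \<times> (L - {x}))"
    using count_pairs[of "{x} \<times> (L - {x})"] assms by auto
  then show ?thesis
    using assms finite_L by (simp add: card_cartesian_product sum.inter_filter finite_blocks cong: if_cong)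
qed

lemma sum_block_crossing:
  assumes "A \<subseteq> L"
  shows "(\<Sum>B\<in>\<B>. card (B \<inter> A) * card (B - A)) = card A * (card L - card A)"
proof -
  have "(A \<times> (L - A)) \<inter> B \<times> B = (B \<inter> A) \<times> (B - A)" if "B \<in> \<B>" for B
    using block_subset[OF that] by auto
  then have "(\<Sum>B\<in>\<B>. card (B \<inter> A) * card (B - A)) = card (A \<times> (L - A))"
    using count_pairs[of "A \<times> (L - A)"] assms by (auto simp: card_cartesian_product)
  then show ?thesis
    using assms finite_subset[OF assms finite_L] by (simp add: card_cartesian_product card_Diff_subset)
qed

lemma sum_block_outside:
  assumes "A \<subseteq> L"
  shows "(\<Sum>B\<in>\<B>. card (B - A) * (card (B - A) - 1)) = (card L - card A) * (card L - card A - 1)"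
proof -
  have "off_diag (L - A) \<inter> B \<times> B = off_diag (B - A)" if "B \<in> \<B>" for B
    using block_subset[OF that] by (auto simp: off_diag_def)
  then have "(\<Sum>B\<in>\<B>. card (off_diag (B - A))) = card (off_diag (L - A))"
    using count_pairs[of "off_diag (L - A)"] by (auto simp: off_diag_def[of "L - A"])
  then show ?thesis
    using assms finite_L finite_subset[OF assms finite_L]
    by (simp add: card_off_diag finite_block card_Diff_subset)
qed

lemma sum_blocks_swap:
  fixes g :: "'a set \<Rightarrow> nat"
  shows "(\<Sum>B\<in>\<B>. card B * g B) = (\<Sum>x\<in>L. \<Sum>B\<in>{B\<in>\<B>. x \<in> B}. g B)"
proof -
  have "card B * g B = (\<Sum>x\<in>{x\<in>L. x \<in> B}. g B)" if "B \<in> \<B>" for B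
  proof -
    have "{x\<in>L. x \<in> B} = B" using block_subset[OF that] by auto
    then show ?thesis by simp
  qed
  then have "(\<Sum>B\<in>\<B>. card B * g B) = (\<Sum>B\<in>\<B>. \<Sum>x\<in>{x\<in>L. x \<in> B}. g B)"
    by (intro sum.cong refl)
  also have "\<dots> = (\<Sum>x\<in>L. \<Sum>B\<in>{B\<in>\<B>. x \<in> B}. g B)"
    by (rule sum.swap_restrict) (auto simp: finite_blocks finite_L)
  finally show ?thesis .
qed

lemma card_blocks_meet_le:
  assumes "A \<in> \<B>" "B \<in> \<B>" "A \<noteq> B" shows "card (B \<inter> A) \<le> 1"
proof -
  have "\<forall>x\<in>B \<inter> A. \<forall>y\<in>B \<inter> A. x = y"
    using assms block_unique by blast
  then show ?thesis
    using finite_block[OF assms(2)] by (simp add: card_le_Suc0_iff_eq)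
qed

lemma card_block_split:
  assumes "B \<in> \<B>" shows "card B = card (B \<inter> A) + card (B - A)"
  using finite_block[OF assms] by (metis card_Int_Diff)

lemma pair_bound:
  fixes w :: "'a set \<Rightarrow> int"
  assumes "\<And>B. B \<in> \<B> \<Longrightarrow> w B \<le> a * (int (card B) * (int (card B) - 1))"
  shows "(\<Sum>B\<in>\<B>. w B) \<le> a * (int (card L) * (int (card L) - 1))"
proof (cases "\<B> = {}")
  \<comment> \<open>Treated apart so that \<open>2 \<le> card L\<close> holds in the other case,
    where natural subtraction is converted into integer subtraction.\<close>
  case True
  then have "card L \<le> 1"
    using block_exists finite_L by (metis One_nat_def card_le_Suc0_iff_eq empty_iff)
  then have "int (card L) * (int (card L) - 1) = 0"
    by (cases "card L = 0") auto
  then show ?thesis using True by (simp only: sum.empty mult_zero_right)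
next
  case False
  then have L: "2 \<le> card L"
    using block_card_ge block_card_le by fastforce
  have "(\<Sum>B\<in>\<B>. w B) \<le> (\<Sum>B\<in>\<B>. a * (int (card B) * (int (card B) - 1)))"
    by (intro sum_mono assms)
  also have "\<dots> = a * int (\<Sum>B\<in>\<B>. card B * (card B - 1))"
    unfolding of_nat_sum sum_distrib_left
    by (intro sum.cong refl) (use block_card_ge in \<open>fastforce simp: of_nat_diff\<close>)
  also have "(\<Sum>B\<in>\<B>. card B * (card B - 1)) = card L * (card L - 1)"
    by (rule sum_block_pairs)
  finally show ?thesis
    using L by (simp add: of_nat_diff)
qed

text \<open>A block other than \<open>A\<close> either misses \<open>A\<close> or meets it in one
  element; in the latter case, with \<open>j\<close> elements outside, it contains \<open>j\<close>
  crossing pairs and \<open>j * (j - 1)\<close> ordered outer pairs. The totals of both kinds are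
  exact counts, so negative rates are allowed as well.\<close>

lemma block_bound:
  fixes w :: "'a set \<Rightarrow> int" and a b :: int
  assumes A: "A \<in> \<B>"
    and miss: "\<And>B. B \<in> \<B> \<Longrightarrow> B \<inter> A = {} \<Longrightarrow> w B \<le> a * (int (card B) * (int (card B) - 1))"
    and meet: "\<And>B j. B \<in> \<B> \<Longrightarrow> B \<noteq> A \<Longrightarrow> card (B \<inter> A) = 1 \<Longrightarrow> card B = Suc j
      \<Longrightarrow> w B \<le> b * int j + a * (int j * (int j - 1))"
  shows "(\<Sum>B\<in>\<B>. w B) \<le> w A + b * (int (card A) * (int (card L) - int (card A)))
    + a * ((int (card L) - int (card A)) * (int (card L) - int (card A) - 1))"
proof -
  let ?c = "\<lambda>B. int (card (B - A)) * (int (card (B - A)) - 1)"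
  have sub: "A \<subseteq> L" using block_subset[OF A] .
  then have le: "card A \<le> card L" using finite_L card_mono by blast
  have point: "w B \<le> b * (int (card (B \<inter> A)) * int (card (B - A))) + a * ?c B"
    if B: "B \<in> \<B> - {A}" for B
  proof (cases "card (B \<inter> A) = 0")
    case True
    then have "B \<inter> A = {}" using B finite_block by auto
    then have "B - A = B" by auto
    then show ?thesis using miss B True \<open>B \<inter> A = {}\<close> by auto
  next
    case False
    then have 1: "card (B \<inter> A) = 1"
      using card_blocks_meet_le[of A B] A B by fastforce
    then have "card B = Suc (card (B - A))"
      using card_block_split[of B A] B by auto
    then show ?thesis using meet[of B "card (B - A)"] 1 B by auto
  qed
  have outer: "int (card L - card A) * int (card L - card A - 1)
    = (int (card L) - int (card A)) * (int (card L) - int (card A) - 1)"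
    using le by (cases "card L = card A") (auto simp: of_nat_diff)
  have "(\<Sum>B\<in>\<B>. w B) = w A + (\<Sum>B\<in>\<B> - {A}. w B)"
    using A finite_blocks by (simp add: sum.remove)
  also have "(\<Sum>B\<in>\<B> - {A}. w B) \<le>
    (\<Sum>B\<in>\<B> - {A}. b * (int (card (B \<inter> A)) * int (card (B - A))) + a * ?c B)"
    by (intro sum_mono point)
  \<comment> \<open>The summand of \<open>A\<close> itself is zero because \<open>A - A\<close> is
    empty, so it can be put back to reach the full counts.\<close>
  also have "\<dots> = (\<Sum>B\<in>\<B>. b * (int (card (B \<inter> A)) * int (card (B - A))) + a * ?c B)"
    using sum.remove[OF finite_blocks A, of "\<lambda>B. b * (int (card (B \<inter> A)) * int (card (B - A))) + a * ?c B"]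
    by simp
  also have "\<dots> = b * (\<Sum>B\<in>\<B>. int (card (B \<inter> A)) * int (card (B - A))) + a * (\<Sum>B\<in>\<B>. ?c B)"
    by (simp add: sum.distrib sum_distrib_left)
  also have "(\<Sum>B\<in>\<B>. int (card (B \<inter> A)) * int (card (B - A)))
      = int (\<Sum>B\<in>\<B>. card (B \<inter> A) * card (B - A))"
    by simp
  also have "(\<Sum>B\<in>\<B>. ?c B) = int (\<Sum>B\<in>\<B>. card (B - A) * (card (B - A) - 1))"
    unfolding of_nat_sum
    by (intro sum.cong refl, rename_tac B, case_tac "card (B - A)") (auto simp: algebra_simps)
  finally show ?thesis
    by (simp only: sum_block_crossing[OF sub] sum_block_outside[OF sub] of_nat_mult outer
        add.assoc add_left_mono) (simp add: of_nat_diff[OF le] algebra_simps)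
qed

section \<open>Weight inequalities for two to ten elements\<close>

lemma weight_bound_2:
  assumes "card L = 2" shows "(\<Sum>B\<in>\<B>. 1 * int (card B) - 0) \<le> 1 * int (card L)"
proof -
  have "(\<Sum>B\<in>\<B>. 1 * int (card B) - 0) \<le> 1 * (int (card L) * (int (card L) - 1))"
    using block_card_ge by (intro pair_bound) (force simp: mult_le_cancel_left1)
  then show ?thesis using assms by simp
qed

lemma block_card_range:
  assumes "B \<in> \<B>" "card L \<le> n" shows "card B \<in> set [2..<Suc n]"
  using block_card_ge[OF assms(1)] block_card_le[OF assms(1)] assms(2) by auto

lemma weight_bound_3:
  assumes "card L = 3" shows "(\<Sum>B\<in>\<B>. 1 * int (card B) - 1) \<le> 1 * int (card L)"
proof -
  have "(\<Sum>B\<in>\<B>. 2 * (int (card B) - 1)) \<le> 1 * (int (card L) * (int (card L) - 1))"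
  proof (rule pair_bound)
    fix B assume "B \<in> \<B>"
    from block_card_range[OF this, of 3] assms show "2 * (int (card B) - 1) \<le> 1 * (int (card B) * (int (card B) - 1))"
      by (auto simp: upt_rec)
  qed
  then show ?thesis using assms by (simp add: sum_subtractf flip: sum_distrib_left)
qed

text \<open>For a block of \<open>k\<close> elements the pairs exceed the weight by
  \<open>(k - 2)^2\<close>.\<close>

lemma weight_bound_4:
  assumes "card L = 4" shows "(\<Sum>B\<in>\<B>. 3 * int (card B) - 4) \<le> 3 * int (card L)"
proof -
  have "(\<Sum>B\<in>\<B>. 3 * int (card B) - 4) \<le> 1 * (int (card L) * (int (card L) - 1))"
  proof (rule pair_bound)
    fix B assume "B \<in> \<B>"
    from block_card_range[OF this, of 4] assms show "3 * int (card B) - 4 \<le> 1 * (int (card B) * (int (card B) - 1))"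
      by (auto simp: upt_rec)
  qed
  then show ?thesis using assms by simp
qed

text \<open>After doubling, the slack of a block of \<open>k\<close> elements is
  \<open>(k - 2) * (k - 3)\<close>.\<close>

lemma weight_bound_5:
  assumes "card L = 5" shows "(\<Sum>B\<in>\<B>. 2 * int (card B) - 3) \<le> 2 * int (card L)"
proof -
  have "(\<Sum>B\<in>\<B>. 2 * (2 * int (card B) - 3)) \<le> 1 * (int (card L) * (int (card L) - 1))"
  proof (rule pair_bound)
    fix B assume "B \<in> \<B>"
    from block_card_range[OF this, of 5] assms
    show "2 * (2 * int (card B) - 3) \<le> 1 * (int (card B) * (int (card B) - 1))"
      by (auto simp: upt_rec)
  qed
  then show ?thesis using assms by (simp add: sum_subtractf flip: sum_distrib_left)
qed

text \<open>The slack of a block of \<open>k\<close> elements is \<open>(k - 3) * (k - 4)\<close>.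
  Equality in the total therefore requires all blocks to have three or four elements, as happens in
  the Fano plane.\<close>

lemma weight_bound_7:
  assumes "card L = 7" shows "(\<Sum>B\<in>\<B>. 1 * int (card B) - 2) \<le> 1 * int (card L)"
proof -
  have "(\<Sum>B\<in>\<B>. 6 * (int (card B) - 2)) \<le> 1 * (int (card L) * (int (card L) - 1))"
  proof (rule pair_bound)
    fix B assume "B \<in> \<B>"
    from block_card_range[OF this, of 7] assms
    show "6 * (int (card B) - 2) \<le> 1 * (int (card B) * (int (card B) - 1))"
      by (auto simp: upt_rec)
  qed
  then show ?thesis using assms by (simp add: sum_subtractf flip: sum_distrib_left)
qed

text \<open>When the weight depends on the size only, the charging conditions become finitely many
  numerical checks, stated over explicit lists so that \<open>upt_rec\<close> can unfold
  them.\<close>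

lemma size_bound:
  fixes f :: "nat \<Rightarrow> int" and a b :: int
  assumes A: "A \<in> \<B>" and n: "card L \<le> n"
    and miss: "\<forall>j\<in>set [2..<Suc n]. f j \<le> a * (int j * (int j - 1))"
    and meet: "\<forall>j\<in>set [1..<n]. f (Suc j) \<le> b * int j + a * (int j * (int j - 1))"
  shows "(\<Sum>B\<in>\<B>. f (card B)) \<le> f (card A) + b * (int (card A) * (int (card L) - int (card A)))
    + a * ((int (card L) - int (card A)) * (int (card L) - int (card A) - 1))"
proof (rule block_bound[OF A])
  fix B assume "B \<in> \<B>"
  then show "f (card B) \<le> a * (int (card B) * (int (card B) - 1))"
    using miss block_card_range n by blast
next
  fix B j assume "B \<in> \<B>" "card B = Suc j"
  then show "f (card B) \<le> b * int j + a * (int j * (int j - 1))"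
    using meet block_card_range[of B n] n by fastforce
qed

text \<open>A triple block weighs 9, while its six ordered pairs pay only \<open>6 * 7 / 5\<close>
  at the uniform rate, so a triple or larger block is taken as \<open>A\<close>. For the doubled
  weight, the rates 4 and 5 are exact for blocks with two or three elements meeting \<open>A\<close>
  (\<open>4 = 4\<close> and \<open>18 = 8 + 10\<close>); with three elements in \<open>A\<close> the
  total \<open>18 + 36 + 30\<close> is twice 42.\<close>

lemma weight_bound_6:
  assumes "card L = 6" shows "(\<Sum>B\<in>\<B>. 7 * int (card B) - 12) \<le> 7 * int (card L)"
proof (cases "\<exists>A\<in>\<B>. 3 \<le> card A")
  case True
  then obtain A where A: "A \<in> \<B>" "3 \<le> card A" by blast
  have "(\<Sum>B\<in>\<B>. 2 * (7 * int (card B) - 12)) \<le> 2 * (7 * int (card A) - 12)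
    + 4 * (int (card A) * (int (card L) - int (card A)))
    + 5 * ((int (card L) - int (card A)) * (int (card L) - int (card A) - 1))"
    using assms by (intro size_bound[OF A(1), of 6]) (auto simp: upt_rec)
  moreover have "card A \<in> {3, 4, 5, 6}"
    using A block_card_range[OF A(1), of 6] assms by (auto simp: upt_rec)
  ultimately show ?thesis using assms by (auto simp: sum_subtractf simp flip: sum_distrib_left)
next
  case False
  have "(\<Sum>B\<in>\<B>. 7 * int (card B) - 12) \<le> 1 * (int (card L) * (int (card L) - 1))"
  proof (rule pair_bound)
    fix B assume "B \<in> \<B>"
    then have "card B = 2" using False block_card_ge by force
    then show "7 * int (card B) - 12 \<le> 1 * (int (card B) * (int (card B) - 1))" by simp
  qed
  then show ?thesis using assms by simp
qed

lemma triple_blocks_through: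
  assumes "x \<in> L"
  shows "2 * card {B\<in>\<B>. x \<in> B \<and> card B = 3} + (\<Sum>B\<in>{B\<in>\<B>. x \<in> B \<and> card B \<noteq> 3}. card B - 1) = card L - 1"
proof -
  have "{B\<in>\<B>. x \<in> B} = {B\<in>\<B>. x \<in> B \<and> card B = 3} \<union> {B\<in>\<B>. x \<in> B \<and> card B \<noteq> 3}" by auto
  then have "card L - 1 = (\<Sum>B\<in>{B\<in>\<B>. x \<in> B \<and> card B = 3} \<union> {B\<in>\<B>. x \<in> B \<and> card B \<noteq> 3}. card B - 1)"
    using sum_star[OF assms] by simp
  also have "\<dots> = (\<Sum>B\<in>{B\<in>\<B>. x \<in> B \<and> card B = 3}. card B - 1) + (\<Sum>B\<in>{B\<in>\<B>. x \<in> B \<and> card B \<noteq> 3}. card B - 1)"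
    by (intro sum.union_disjoint) (auto simp: finite_blocks)
  finally show ?thesis by simp
qed

text \<open>Without blocks of four or more elements only triple blocks have positive weight, namely
  1. Every element has seven neighbours, an odd number, hence at most three triple blocks, and
  counting incidences gives at most eight in all. If a larger block exists, charging outer pairs
  suffices: for four elements in \<open>A\<close> the doubled total is \<open>4 + 12\<close>,
  exactly twice 8.\<close>

lemma weight_bound_8:
  assumes "card L = 8" shows "(\<Sum>B\<in>\<B>. 1 * int (card B) - 2) \<le> 1 * int (card L)"
proof (cases "\<exists>A\<in>\<B>. 4 \<le> card A")
  case True
  then obtain A where A: "A \<in> \<B>" "4 \<le> card A" by blast
  have "(\<Sum>B\<in>\<B>. 2 * (int (card B) - 2)) \<le> 2 * (int (card A) - 2)
    + 0 * (int (card A) * (int (card L) - int (card A)))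
    + 1 * ((int (card L) - int (card A)) * (int (card L) - int (card A) - 1))"
    using assms by (intro size_bound[OF A(1), of 8]) (auto simp: upt_rec)
  moreover have "card A \<in> {4, 5, 6, 7, 8}"
    using A block_card_range[OF A(1), of 8] assms by (auto simp: upt_rec)
  ultimately show ?thesis using assms by (auto simp: sum_subtractf simp flip: sum_distrib_left)
next
  case False
  let ?T = "{B\<in>\<B>. card B = 3}"
  have "3 * card ?T = (\<Sum>B\<in>\<B>. card B * (if card B = 3 then 1 else 0))"
    by (simp add: sum.If_cases finite_blocks if_distrib Int_def cong: if_cong)
  also have "\<dots> = (\<Sum>x\<in>L. \<Sum>B\<in>{B\<in>\<B>. x \<in> B}. if card B = 3 then 1 else 0)"
    by (rule sum_blocks_swap)
  also have "\<dots> \<le> (\<Sum>x\<in>L. 3)"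
  proof (rule sum_mono)
    fix x assume "x \<in> L"
    then have "2 * card {B\<in>\<B>. x \<in> B \<and> card B = 3} \<le> 7"
      using triple_blocks_through[of x] assms by linarith
    then show "(\<Sum>B\<in>{B\<in>\<B>. x \<in> B}. if card B = 3 then 1 else 0) \<le> (3::nat)"
      by (simp add: sum.If_cases finite_blocks Int_def conj_assoc)
  qed
  finally have "card ?T \<le> 8" using assms by simp
  moreover have "(\<Sum>B\<in>\<B>. 1 * int (card B) - 2) = (\<Sum>B\<in>\<B>. if card B = 3 then 1 else 0)"
  proof (rule sum.cong[OF refl])
    fix B assume "B \<in> \<B>"
    then have "card B = 2 \<or> card B = 3" using False block_card_ge by force
    then show "1 * int (card B) - 2 = (if card B = 3 then 1 else 0)" by auto
  qed
  ultimately show ?thesis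
    using assms by (simp add: sum.If_cases finite_blocks Int_def)
qed

lemma triple_blocks_meeting:
  assumes A: "A \<in> \<B>" "card A \<noteq> 3"
    and m: "\<And>x. x \<in> A \<Longrightarrow> card {B\<in>\<B>. x \<in> B \<and> card B = 3} \<le> m"
  shows "card {B\<in>\<B>. B \<inter> A \<noteq> {} \<and> card B = 3} \<le> card A * m"
proof -
  have "{B\<in>\<B>. B \<inter> A \<noteq> {} \<and> card B = 3} \<subseteq> (\<Union>x\<in>A. {B\<in>\<B>. x \<in> B \<and> card B = 3})" by auto
  then have "card {B\<in>\<B>. B \<inter> A \<noteq> {} \<and> card B = 3} \<le> card (\<Union>x\<in>A. {B\<in>\<B>. x \<in> B \<and> card B = 3})"
    by (intro card_mono) (auto simp: finite_blocks finite_block[OF A(1)])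
  also have "\<dots> \<le> (\<Sum>x\<in>A. card {B\<in>\<B>. x \<in> B \<and> card B = 3})"
    by (rule card_UN_le) (rule finite_block[OF A(1)])
  also have "\<dots> \<le> (\<Sum>x\<in>A. m)" by (intro sum_mono m)
  finally show ?thesis by simp
qed

lemma weight_bound_9:
  assumes "card L = 9" shows "(\<Sum>B\<in>\<B>. 4 * int (card B) - 9) \<le> 4 * int (card L)"
proof -
  consider A where "A \<in> \<B>" "5 \<le> card A" | A where "A \<in> \<B>" "card A = 4"
    | "\<forall>A\<in>\<B>. card A \<le> 3" by force
  then show ?thesis
  proof cases
    case A: 1
    have "(\<Sum>B\<in>\<B>. 2 * (4 * int (card B) - 9)) \<le> 2 * (4 * int (card A) - 9)
      + 0 * (int (card A) * (int (card L) - int (card A)))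
      + 3 * ((int (card L) - int (card A)) * (int (card L) - int (card A) - 1))"
      using assms by (intro size_bound[OF A(1), of 9]) (auto simp: upt_rec)
    moreover have "card A \<in> {5, 6, 7, 8, 9}"
      using A block_card_range[OF A(1), of 9] assms by (auto simp: upt_rec)
    ultimately show ?thesis using assms by (auto simp: sum_subtractf simp flip: sum_distrib_left)
  next
    case A: 2
    \<comment> \<open>Charging pairs alone gives 37 instead of 36. Each \<open>x \<in> A\<close> has five neighbours outside \<open>A\<close>,
      an odd number, hence at most two triple blocks, and this removes the excess.\<close>
    let ?T = "{B\<in>\<B>. B \<inter> A \<noteq> {} \<and> card B = 3}"
    let ?w = "\<lambda>B. 4 * (4 * int (card B) - 9) - (if B \<inter> A \<noteq> {} \<and> card B = 3 then 2 else 0)"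
    have "(\<Sum>B\<in>\<B>. ?w B) \<le> ?w A + 0 * (int (card A) * (int (card L) - int (card A)))
      + 5 * ((int (card L) - int (card A)) * (int (card L) - int (card A) - 1))"
    proof (rule block_bound[OF A(1)])
      fix B assume "B \<in> \<B>" "B \<inter> A = {}"
      then show "?w B \<le> 5 * (int (card B) * (int (card B) - 1))"
        using block_card_range[of B 9] assms by (auto simp: upt_rec)
    next
      fix B j assume B: "B \<in> \<B>" "card (B \<inter> A) = 1" "card B = Suc j"
      then have "B \<inter> A \<noteq> {}" by auto
      then show "?w B \<le> 0 * int j + 5 * (int j * (int j - 1))"
        using block_card_range[of B 9] assms B by (auto simp: upt_rec)
    qed
    moreover have "(\<Sum>B\<in>\<B>. ?w B) = 4 * (\<Sum>B\<in>\<B>. 4 * int (card B) - 9) - 2 * int (card ?T)"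
      by (simp add: sum_subtractf sum.If_cases finite_blocks Int_def flip: sum_distrib_left)
    moreover have "card ?T \<le> card A * 2"
    proof (rule triple_blocks_meeting[OF A(1)])
      fix x assume x: "x \<in> A"
      let ?R = "{B\<in>\<B>. x \<in> B \<and> card B \<noteq> 3}"
      have "(\<Sum>B\<in>{A}. card B - 1) \<le> (\<Sum>B\<in>?R. card B - 1)"
        using A x by (intro sum_mono2) (auto simp: finite_blocks)
      moreover have "2 * card {B\<in>\<B>. x \<in> B \<and> card B = 3} + (\<Sum>B\<in>?R. card B - 1) = 8"
        using triple_blocks_through[of x] x block_subset[OF A(1)] assms by auto
      ultimately show "card {B\<in>\<B>. x \<in> B \<and> card B = 3} \<le> 2"
        using A by simp
    qed (use A in auto)
    ultimately show ?thesis using assms A by simp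
  next
    \<comment> \<open>The charge is exact for triple blocks and wasteful for double ones. Equality
      holds for twelve triple blocks on nine elements, the affine plane of order 3.\<close>
    case 3
    have "(\<Sum>B\<in>\<B>. 2 * (4 * int (card B) - 9)) \<le> 1 * (int (card L) * (int (card L) - 1))"
    proof (rule pair_bound)
      fix B assume "B \<in> \<B>"
      then have "card B = 2 \<or> card B = 3" using 3 block_card_ge by force
      then show "2 * (4 * int (card B) - 9) \<le> 1 * (int (card B) * (int (card B) - 1))" by auto
    qed
    then show ?thesis using assms by (simp add: sum_subtractf flip: sum_distrib_left)
  qed
qed

text \<open>The critical case is a largest block of four elements. For the sixfold weight, the rates
  4 and 17 are exact for blocks of three or four elements meeting \<open>A\<close>
  (\<open>42 = 8 + 34\<close> and \<open>114 = 12 + 102\<close>), and the total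
  \<open>114 + 96 + 510\<close> is precisely six times 120. Larger blocks and the case of triple
  blocks only leave slack.\<close>

lemma weight_bound_10:
  assumes "card L = 10" shows "(\<Sum>B\<in>\<B>. 12 * int (card B) - 29) \<le> 12 * int (card L)"
proof -
  consider A where "A \<in> \<B>" "5 \<le> card A" | A where "A \<in> \<B>" "card A = 4"
    | "\<forall>A\<in>\<B>. card A \<le> 3" by force
  then show ?thesis
  proof cases
    case A: 1
    have "(\<Sum>B\<in>\<B>. 2 * (12 * int (card B) - 29)) \<le> 2 * (12 * int (card A) - 29)
      + 0 * (int (card A) * (int (card L) - int (card A)))
      + 7 * ((int (card L) - int (card A)) * (int (card L) - int (card A) - 1))"
      using assms by (intro size_bound[OF A(1), of 10]) (auto simp: upt_rec)
    moreover have "card A \<in> {5, 6, 7, 8, 9, 10}"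
      using A block_card_range[OF A(1), of 10] assms by (auto simp: upt_rec)
    ultimately show ?thesis using assms by (auto simp: sum_subtractf simp flip: sum_distrib_left)
  next
    case A: 2
    have "(\<Sum>B\<in>\<B>. 6 * (12 * int (card B) - 29)) \<le> 6 * (12 * int (card A) - 29)
      + 4 * (int (card A) * (int (card L) - int (card A)))
      + 17 * ((int (card L) - int (card A)) * (int (card L) - int (card A) - 1))"
      using assms by (intro size_bound[OF A(1), of 10]) (auto simp: upt_rec)
    then show ?thesis using assms A by (auto simp: sum_subtractf simp flip: sum_distrib_left)
  next
    case 3
    have "(\<Sum>B\<in>\<B>. 6 * (12 * int (card B) - 29)) \<le> 7 * (int (card L) * (int (card L) - 1))"
    proof (rule pair_bound)
      fix B assume "B \<in> \<B>"
      then have "card B = 2 \<or> card B = 3" using 3 block_card_ge by force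
      then show "6 * (12 * int (card B) - 29) \<le> 7 * (int (card B) * (int (card B) - 1))" by auto
    qed
    then show ?thesis using assms by (simp add: sum_subtractf flip: sum_distrib_left)
  qed
qed

section \<open>Numbers of blocks by size, in total and through one element\<close>

definition num :: "nat \<Rightarrow> nat" where "num r = card {B\<in>\<B>. card B = r}"

definition deg :: "nat \<Rightarrow> 'a \<Rightarrow> nat" where "deg r x = card {B\<in>\<B>. x \<in> B \<and> card B = r}"

lemma sum_by_size:
  fixes g :: "nat \<Rightarrow> 'b::comm_semiring_1"
  assumes "\<C> \<subseteq> \<B>" "\<And>B. B \<in> \<C> \<Longrightarrow> card B \<le> m"
  shows "(\<Sum>B\<in>\<C>. g (card B)) = (\<Sum>r=2..m. of_nat (card {B\<in>\<C>. card B = r}) * g r)"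
proof -
  have fin: "finite \<C>" using assms(1) finite_blocks finite_subset by blast
  have "card ` \<C> \<subseteq> {2..m}" using assms block_card_ge by auto
  then have "(\<Sum>B\<in>\<C>. g (card B)) = (\<Sum>r=2..m. \<Sum>B\<in>{B\<in>\<C>. card B = r}. g (card B))"
    using fin by (intro sum.group[symmetric]) auto
  also have "\<dots> = (\<Sum>r=2..m. of_nat (card {B\<in>\<C>. card B = r}) * g r)"
    by (intro sum.cong refl) simp
  finally show ?thesis .
qed

lemma sum_blocks_by_size:
  fixes g :: "nat \<Rightarrow> 'b::comm_semiring_1"
  assumes "\<forall>B\<in>\<B>. card B \<le> m"
  shows "(\<Sum>B\<in>\<B>. g (card B)) = (\<Sum>r=2..m. of_nat (num r) * g r)"
  using sum_by_size[of \<B> m g] assms by (simp add: num_def)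

lemma sum_star_by_size:
  assumes "\<forall>B\<in>\<B>. card B \<le> m" "x \<in> L"
  shows "(\<Sum>r=2..m. deg r x * (r - 1)) = card L - 1"
  using sum_by_size[of "{B\<in>\<B>. x \<in> B}" m "\<lambda>r. r - 1"] sum_star[OF assms(2)] assms(1)
  by (simp add: deg_def conj_assoc)

lemma sum_deg: "(\<Sum>x\<in>L. deg r x) = r * num r"
proof -
  have "r * num r = (\<Sum>B\<in>\<B>. card B * (if card B = r then 1 else 0))"
    by (simp add: num_def sum.If_cases finite_blocks if_distrib Int_def cong: if_cong)
  also have "\<dots> = (\<Sum>x\<in>L. \<Sum>B\<in>{B\<in>\<B>. x \<in> B}. if card B = r then 1 else 0)"
    by (rule sum_blocks_swap)
  also have "\<dots> = (\<Sum>x\<in>L. deg r x)"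
    by (simp add: deg_def sum.If_cases finite_blocks Int_def conj_assoc)
  finally show ?thesis by simp
qed

lemma deg_eq_0_iff: "deg r x = 0 \<longleftrightarrow> (\<forall>B\<in>\<B>. x \<in> B \<longrightarrow> card B \<noteq> r)"
  by (auto simp: deg_def finite_blocks)

lemma deg_ge_card:
  assumes "\<C> \<subseteq> \<B>" "\<And>C. C \<in> \<C> \<Longrightarrow> x \<in> C \<and> card C = r"
  shows "card \<C> \<le> deg r x"
  unfolding deg_def using assms by (intro card_mono) (auto simp: finite_blocks)

lemma blocks_meet_singleton:
  assumes "B \<in> \<B>" "C \<in> \<B>" "B \<noteq> C" "x \<in> B" "x \<in> C"
  shows "B \<inter> C = {x}"
  using assms block_unique by blast

lemma card_Un_blocks:
  assumes "B \<in> \<B>" "C \<in> \<B>" "B \<noteq> C" "x \<in> B" "x \<in> C"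
  shows "card (B \<union> C) = card B + card C - 1"
  using card_Un_Int[of B C] blocks_meet_singleton[OF assms] finite_block assms by simp

end

section \<open>Ten elements violating the complex bound -34/15\<close>

locale ten_lines = linear_space +
  assumes card_L: "card L = 10"
    and card_le_4: "\<forall>B\<in>\<B>. card B \<le> 4"
    and excess: "150 < (\<Sum>B\<in>\<B>. 15 * int (card B) - 34)"
begin

text \<open>There are 45 unordered pairs, and blocks of two, three and four elements contribute -4,
  11 and 26 to \<open>excess\<close>. Eliminating \<open>num 3\<close> gives
  \<open>23 * num 2 < 45 + 12 * num 4\<close>, so double blocks are rare.\<close>

lemma num_eqs:
  "num 2 + 3 * num 3 + 6 * num 4 = 45"
  "150 + 4 * num 2 < 11 * num 3 + 26 * num 4"
proof -
  have "{2..4} = {2, 3, 4::nat}" by auto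
  then show "num 2 + 3 * num 3 + 6 * num 4 = 45" "150 + 4 * num 2 < 11 * num 3 + 26 * num 4"
    using sum_blocks_by_size[OF card_le_4, of "\<lambda>r. r * (r - 1)"] sum_block_pairs card_L
      sum_blocks_by_size[OF card_le_4, of "\<lambda>r. 15 * int r - 34"] excess
    by auto
qed

lemma deg_eq:
  assumes "x \<in> L" shows "deg 2 x + 2 * deg 3 x + 3 * deg 4 x = 9"
proof -
  have "{2..4} = {2, 3, 4::nat}" by auto
  then show ?thesis
    using sum_star_by_size[OF card_le_4 assms] card_L by simp
qed

text \<open>The three blocks through \<open>x\<close> cover all ten elements. An element of
  \<open>A\<^sub>2 - {x}\<close> without double blocks is joined to each element of
  \<open>A\<^sub>1 - {x}\<close> by a triple block ending in \<open>A\<^sub>3 - {x}\<close>, which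
  is a complete row of a Latin square. There are too few double blocks to spoil two of the three
  rows.\<close>

lemma concurrent_four_points:
  assumes x: "x \<in> L" "3 \<le> deg 4 x"
  obtains A\<^sub>1 A\<^sub>2 A\<^sub>3 q q' where
    "A\<^sub>1 \<in> \<B>" "A\<^sub>2 \<in> \<B>" "A\<^sub>3 \<in> \<B>" "A\<^sub>1 \<noteq> A\<^sub>2" "A\<^sub>1 \<noteq> A\<^sub>3" "A\<^sub>2 \<noteq> A\<^sub>3"
    "x \<in> A\<^sub>1" "x \<in> A\<^sub>2" "x \<in> A\<^sub>3" "card A\<^sub>1 = 4" "card A\<^sub>2 = 4" "card A\<^sub>3 = 4"
    "q \<in> A\<^sub>2 - {x}" "q' \<in> A\<^sub>2 - {x}" "q \<noteq> q'"
    "\<And>p r. r \<in> {q, q'} \<Longrightarrow> p \<in> A\<^sub>1 - {x} \<Longrightarrow> \<exists>B\<in>\<B>. \<exists>s\<in>A\<^sub>3 - {x}. {p, r, s} \<subseteq> B"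
proof -
  let ?F = "{B\<in>\<B>. x \<in> B \<and> card B = 4}"
  have "card ?F = 3" using x deg_eq[of x] by (simp add: deg_def)
  then obtain A1 A2 A3 where F: "?F = {A1, A2, A3}" "A1 \<noteq> A2" "A2 \<noteq> A3" "A1 \<noteq> A3"
    by (auto simp: card_3_iff)
  have "A1 \<in> ?F" "A2 \<in> ?F" "A3 \<in> ?F" unfolding F by auto
  then have A: "A1 \<in> \<B>" "A2 \<in> \<B>" "A3 \<in> \<B>" "x \<in> A1" "x \<in> A2" "x \<in> A3"
    "card A1 = 4" "card A2 = 4" "card A3 = 4" by auto
  note [simp] = A
  have I: "A1 \<inter> A2 = {x}" "A1 \<inter> A3 = {x}" "A2 \<inter> A3 = {x}"
    using blocks_meet_singleton F(2-) A by blast+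
  have fin: "finite A1" "finite A2" "finite A3" using finite_block by auto
  have "card (A1 \<union> A2 \<union> A3) = 10"
  proof -
    have "card (A1 \<union> A2) = 7" using card_Un_blocks[of A1 A2 x] F by simp
    moreover have "(A1 \<union> A2) \<inter> A3 = {x}" using I by auto
    ultimately show ?thesis
      using card_Un_Int[of "A1 \<union> A2" A3] fin by simp
  qed
  moreover have "A1 \<union> A2 \<union> A3 \<subseteq> L" using A block_subset by blast
  ultimately have L: "L = A1 \<union> A2 \<union> A3"
    using card_subset_eq[OF finite_L] card_L by metis
  \<comment> \<open>A further block meets each of the three blocks covering \<open>L\<close> at most
    once, so it has at most three elements.\<close>
  have four: "B \<in> {A1, A2, A3}" if B: "B \<in> \<B>" "card B = 4" for B
  proof (rule ccontr)
    assume n: "B \<notin> {A1, A2, A3}"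
    have "B = (B \<inter> A1) \<union> (B \<inter> A2) \<union> (B \<inter> A3)" using block_subset[OF B(1)] L by auto
    then have "card B \<le> card (B \<inter> A1) + card (B \<inter> A2) + card (B \<inter> A3)"
      by (metis (no_types, lifting) add_le_mono1 card_Un_le le_trans)
    moreover have "card (B \<inter> A1) \<le> 1" "card (B \<inter> A2) \<le> 1" "card (B \<inter> A3) \<le> 1"
      using card_blocks_meet_le[of A1 B] card_blocks_meet_le[of A2 B] card_blocks_meet_le[of A3 B] B A n
      by (metis insertI1 insertI2)+
    ultimately show False using B by linarith
  qed
  have "{B\<in>\<B>. card B = 4} = {A1, A2, A3}" using four by auto
  then have "num 4 = 3" using F by (simp add: num_def)
  then have T2: "num 2 \<le> 3" using num_eqs by linarith
  \<comment> \<open>Besides the three neighbours inside \<open>A2\<close>, the element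
    \<open>q\<close> has six neighbours, and triple blocks cover them two at a time.\<close>
  have even: "even (deg 2 q)" if q: "q \<in> A2 - {x}" for q
  proof -
    have "q \<notin> A1" "q \<notin> A3" using q I by auto
    then have "{B\<in>\<B>. q \<in> B \<and> card B = 4} = {A2}" using four q by auto
    then have "deg 4 q = 1" by (simp add: deg_def)
    then have "deg 2 q = 2 * (3 - deg 3 q)" using deg_eq[of q] L q by auto
    then show ?thesis by simp
  qed
  \<comment> \<open>Two spoiled elements would each need two double blocks. These cannot be shared,
    because \<open>q\<close> and \<open>q'\<close> already lie together in \<open>A2\<close>, so at
    least four would be needed while \<open>num 2\<close> is at most 3.\<close>
  have bad: "q = q'" if q: "q \<in> A2 - {x}" "q' \<in> A2 - {x}" "deg 2 q \<noteq> 0" "deg 2 q' \<noteq> 0" for q q'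
  proof (rule ccontr)
    assume ne: "q \<noteq> q'"
    let ?E = "\<lambda>q. {B\<in>\<B>. q \<in> B \<and> card B = 2}"
    have "?E q \<inter> ?E q' = {}"
    proof (rule ccontr)
      assume "?E q \<inter> ?E q' \<noteq> {}"
      then obtain B where "B \<in> \<B>" "q \<in> B" "q' \<in> B" "card B = 2" by blast
      then show False using block_unique[of B A2 q q'] q ne by auto
    qed
    then have "deg 2 q + deg 2 q' = card (?E q \<union> ?E q')"
      unfolding deg_def by (intro card_Un_disjoint[symmetric]) (auto simp: finite_blocks)
    also have "\<dots> \<le> num 2"
      unfolding num_def by (intro card_mono) (auto simp: finite_blocks)
    finally have "deg 2 q + deg 2 q' \<le> 3" using T2 by simp
    moreover have "2 \<le> deg 2 q" "2 \<le> deg 2 q'"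
      using even[OF q(1)] even[OF q(2)] q by (auto elim!: evenE)
    ultimately show False by simp
  qed
  have "card (A2 - {x}) = 3" using fin by simp
  then obtain a b c where abc: "A2 - {x} = {a, b, c}" "a \<noteq> b" "b \<noteq> c" "a \<noteq> c"
    unfolding card_3_iff by blast
  have mem: "a \<in> A2 - {x}" "b \<in> A2 - {x}" "c \<in> A2 - {x}" unfolding abc by auto
  then consider "deg 2 a = 0" "deg 2 b = 0" | "deg 2 b = 0" "deg 2 c = 0" | "deg 2 a = 0" "deg 2 c = 0"
    using bad[of a b] bad[of b c] bad[of a c] abc(2-) by blast
  then obtain q q' where q: "q \<in> A2 - {x}" "q' \<in> A2 - {x}" "q \<noteq> q'" "deg 2 q = 0" "deg 2 q' = 0"
    using mem abc(2-) by (cases; metis)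
  have third: "\<exists>B\<in>\<B>. \<exists>s\<in>A3 - {x}. {p, r, s} \<subseteq> B" if r: "r \<in> {q, q'}" and p: "p \<in> A1 - {x}" for p r
  proof -
    have r2: "r \<in> A2 - {x}" "deg 2 r = 0" using r q by auto
    have ne: "p \<noteq> r" using r2 p I by auto
    obtain B where B: "B \<in> \<B>" "p \<in> B" "r \<in> B"
      using block_exists[of p r] ne p r2 L by auto
    have ne3: "B \<noteq> A1" "B \<noteq> A2" "B \<noteq> A3" using I B p r2 by auto
    have "card B \<noteq> 2" using r2 B deg_eq_0_iff by auto
    moreover have "card B \<noteq> 4" using four[of B] B ne3 by auto
    moreover have "2 \<le> card B" "card B \<le> 4" using B block_card_ge card_le_4 by auto
    ultimately have "card B = 3" by linarith
    then have "card (B - {p, r}) = 1"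
      using B ne finite_block[OF B(1)] by (simp add: card_Diff_subset)
    then obtain s where s: "s \<in> B" "s \<noteq> p" "s \<noteq> r" by (auto simp: card_1_singleton_iff)
    have "s \<notin> A1" using block_unique[of B A1 s p] B s p ne3 by auto
    moreover have "s \<notin> A2" using block_unique[of B A2 s r] B s r2 ne3 by auto
    moreover have "s \<in> L" using s B block_subset by auto
    ultimately have "s \<in> A3 - {x}" using L by auto
    then show ?thesis using B s by auto
  qed
  show thesis
    by (rule that[OF A(1-3) F(2,4,3) A(4-9) q(1-3) third])
qed

text \<open>By \<open>deg_eq\<close>, \<open>deg 2 x\<close> and \<open>deg 4 x\<close> have
  opposite parity. With \<open>deg 4 x\<close> at most 2 this yields the two inequalities in
  \<open>ge\<close>; their sums over \<open>L\<close>, \<open>num_eqs\<close> and divisibility of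
  \<open>num 2\<close> by 3 leave only \<open>num 2 = 3\<close>. For \<open>num 4 = 4\<close> the
  first sum is an equality, \<open>16 = 16\<close>, so it is an equality at every element.\<close>

lemma four_blocks_case:
  assumes deg4: "\<forall>x\<in>L. deg 4 x \<le> 2"
  shows "num 2 = 3" "num 4 = 3 \<or> num 4 = 4"
    "num 4 = 4 \<Longrightarrow> x \<in> L \<Longrightarrow> deg 4 x = deg 2 x + 1"
proof -
  have ge: "deg 4 x \<le> deg 2 x + 1" "1 \<le> deg 2 x + deg 4 x" if "x \<in> L" for x
  proof -
    have "deg 2 x + 2 * deg 3 x + 3 * deg 4 x = 9" "deg 4 x \<le> 2"
      using deg_eq deg4 that by auto
    then show "deg 4 x \<le> deg 2 x + 1" "1 \<le> deg 2 x + deg 4 x" by presburger+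
  qed
  have "(\<Sum>x\<in>L. deg 4 x) \<le> (\<Sum>x\<in>L. deg 2 x + 1)" by (intro sum_mono ge)
  then have 1: "4 * num 4 \<le> 2 * num 2 + 10" using card_L by (simp only: sum.distrib sum_deg sum_constant) simp
  have "(\<Sum>x\<in>L. 1) \<le> (\<Sum>x\<in>L. deg 2 x + deg 4 x)" by (intro sum_mono ge)
  then have 2: "10 \<le> 2 * num 2 + 4 * num 4" using card_L by (simp add: sum.distrib sum_deg)
  have "3 * (15 - num 3 - 2 * num 4) = num 2" using num_eqs by simp
  then have "3 dvd num 2" by (metis dvd_triv_left)
  moreover have "num 2 \<le> 4" using 1 num_eqs by linarith
  moreover have "num 2 \<noteq> 0"
  proof
    assume "num 2 = 0"
    then have "4 * num 4 = 10" using 1 2 by simp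
    then show False by presburger
  qed
  ultimately have "num 2 = 3" by (auto elim!: dvdE)
  moreover from this have "num 4 = 3 \<or> num 4 = 4" using 1 num_eqs by linarith
  ultimately have "num 2 = 3 \<and> (num 4 = 3 \<or> num 4 = 4)" by simp
  then show T: "num 2 = 3" "num 4 = 3 \<or> num 4 = 4" by auto
  assume "num 4 = 4" "x \<in> L"
  then have "(\<Sum>x\<in>L. deg 4 x) = (\<Sum>x\<in>L. deg 2 x + 1)"
    using T card_L by (simp only: sum.distrib sum_deg sum_constant) simp
  then show "deg 4 x = deg 2 x + 1"
    using \<open>x \<in> L\<close> sum_mono_inv[OF _ ge(1) \<open>x \<in> L\<close> finite_L] by auto
qed

text \<open>\<open>A\<close> and \<open>B\<close> use up six of the nine neighbours of
  \<open>p\<close>, so the block joining \<open>p\<close> to another one stays among the remaining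
  three. With four elements it would be a third such block through \<open>p\<close>.\<close>

lemma residual_block:
  assumes A: "A \<in> \<B>" "B \<in> \<B>" "A \<noteq> B" "card A = 4" "card B = 4" "p \<in> A" "p \<in> B"
    and p: "deg 4 p \<le> 2" and y: "y \<in> L" "y \<notin> A" "y \<notin> B"
  obtains T where "T \<in> \<B>" "p \<in> T" "y \<in> T" "T \<subseteq> insert p (L - (A \<union> B))" "card T \<le> 3"
proof -
  have "p \<in> L" "p \<noteq> y" using A y block_subset by auto
  then obtain T where T: "T \<in> \<B>" "p \<in> T" "y \<in> T" using block_exists[of p y] y by auto
  have ne: "T \<noteq> A" "T \<noteq> B" using T y by auto
  then have "T \<inter> A = {p}" "T \<inter> B = {p}" using blocks_meet_singleton T A by auto
  moreover have "T \<subseteq> L" using T block_subset by auto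
  ultimately have "T \<subseteq> insert p (L - (A \<union> B))" by auto
  moreover have "card T \<noteq> 4"
  proof
    assume "card T = 4"
    then have "card {A, B, T} \<le> deg 4 p" using T A by (intro deg_ge_card) auto
    then show False using A(3) ne p by simp
  qed
  moreover have "card T \<le> 4" using T card_le_4 by auto
  ultimately show thesis using that T by force
qed

lemma card_residual:
  assumes "A \<in> \<B>" "B \<in> \<B>" "A \<noteq> B" "card A = 4" "card B = 4" "p \<in> A" "p \<in> B"
  shows "card (L - (A \<union> B)) = 3"
proof -
  have "A \<union> B \<subseteq> L" using assms block_subset by auto
  then show ?thesis
    using card_Un_blocks[of A B p] assms finite_block card_L by (simp add: card_Diff_subset)
qed

text \<open>\<open>C\<close> meets \<open>A\<close> and \<open>B\<close> at most once each, so at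
  least two elements \<open>u\<close>, \<open>v\<close> of \<open>C\<close> lie outside both. The
  blocks joining \<open>p\<close> to them differ, since \<open>u\<close> and \<open>v\<close>
  already share \<open>C\<close>. Only one of these blocks can contain \<open>w\<close>; the other
  is a double block.\<close>

lemma three_four_blocks_residual:
  assumes F: "{B\<in>\<B>. card B = 4} = {A, B, C}" "A \<noteq> B" "B \<noteq> C" "A \<noteq> C"
    and p: "p \<in> A" "p \<in> B" "deg 4 p \<le> 2"
  obtains u v w where "L - (A \<union> B) = {u, v, w}" "u \<noteq> v" "u \<noteq> w" "v \<noteq> w" "u \<in> C" "v \<in> C" "{p, u} \<in> \<B>"
proof -
  have "A \<in> {B\<in>\<B>. card B = 4}" "B \<in> {B\<in>\<B>. card B = 4}" "C \<in> {B\<in>\<B>. card B = 4}"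
    unfolding F by auto
  then have A: "A \<in> \<B>" "B \<in> \<B>" "C \<in> \<B>" "card A = 4" "card B = 4" "card C = 4" by auto
  let ?R = "L - (A \<union> B)"
  have R: "card ?R = 3" using card_residual[of A B p] A p F by auto
  have fin: "finite A" "finite B" "finite C" using A finite_block by auto
  have "C \<subseteq> (C \<inter> A) \<union> (C \<inter> B) \<union> (C \<inter> ?R)" using A block_subset by auto
  then have "card C \<le> card ((C \<inter> A) \<union> (C \<inter> B) \<union> (C \<inter> ?R))"
    by (rule card_mono[rotated]) (use fin in auto)
  also have "\<dots> \<le> card ((C \<inter> A) \<union> (C \<inter> B)) + card (C \<inter> ?R)" by (rule card_Un_le)
  also have "\<dots> \<le> card (C \<inter> A) + card (C \<inter> B) + card (C \<inter> ?R)" by (simp add: card_Un_le)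
  finally have "2 \<le> card (C \<inter> ?R)"
    using card_blocks_meet_le[OF A(1,3) F(4)] card_blocks_meet_le[OF A(2,3) F(3)] A by linarith
  then have "\<not> card (C \<inter> ?R) \<le> Suc 0" by simp
  then obtain u v where uv: "u \<in> C \<inter> ?R" "v \<in> C \<inter> ?R" "u \<noteq> v"
    using card_le_Suc0_iff_eq[of "C \<inter> ?R"] fin by auto
  have "card (?R - {u, v}) = 1"
    using R uv finite_L by (subst card_Diff_subset) auto
  then obtain w where "?R - {u, v} = {w}" by (auto simp: card_1_singleton_iff)
  then have w: "?R = {u, v, w}" "u \<noteq> w" "v \<noteq> w" using uv by auto
  obtain T where T: "T \<in> \<B>" "p \<in> T" "u \<in> T" "T \<subseteq> insert p ?R" "card T \<le> 3"
    by (rule residual_block[of A B p u]) (use A F(2) p uv in auto)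
  obtain S where S: "S \<in> \<B>" "p \<in> S" "v \<in> S" "S \<subseteq> insert p ?R" "card S \<le> 3"
    by (rule residual_block[of A B p v]) (use A F(2) p uv in auto)
  have ne: "T \<noteq> C" "S \<noteq> C" using T S A by auto
  have vT: "v \<notin> T" using block_unique[of T C u v] T A ne uv by auto
  have uS: "u \<notin> S" using block_unique[of S C u v] S A ne uv by auto
  have pw: "p \<noteq> w" using w p by auto
  have "w \<notin> T \<or> w \<notin> S" using block_unique[of T S p w] T S uS pw by auto
  then show thesis
  proof
    assume "w \<notin> T"
    then have "T = {p, u}" using T vT w by auto
    then show thesis using that[of u v w] w uv T by auto
  next
    assume "w \<notin> S"
    then have "S = {p, v}" using S uS w by auto
    then show thesis using that[of v u w] w uv S by auto
  qed
qed

text \<open>The double blocks are forced one by one: one starts at \<open>p\<close>, one at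
  \<open>q\<close>, and parity at their other ends \<open>u\<close>, \<open>u'\<close> forces the
  third to be \<open>{u, u'}\<close>. This exhausts \<open>num 2 = 3\<close>, but \<open>w\<close>,
  which lies in no block of four elements, needs a double block too.\<close>

lemma three_four_blocks_chain:
  assumes deg4: "\<forall>x\<in>L. deg 4 x \<le> 2"
    and F: "{B\<in>\<B>. card B = 4} = {A, B, C}" "A \<noteq> B" "B \<noteq> C" "A \<noteq> C"
    and p: "p \<in> A" "p \<in> B" and q: "q \<in> B" "q \<in> C"
  shows False
proof -
  have "A \<in> {B\<in>\<B>. card B = 4}" "B \<in> {B\<in>\<B>. card B = 4}" "C \<in> {B\<in>\<B>. card B = 4}"
    unfolding F by auto
  then have A: "A \<in> \<B>" "B \<in> \<B>" "C \<in> \<B>" "card A = 4" "card B = 4" "card C = 4" by auto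
  have pq: "p \<in> L" "q \<in> L" using p q A block_subset by auto
  have deg4_eq: "deg 4 x = card {X\<in>{A, B, C}. x \<in> X}" for x
  proof -
    have "{B\<in>\<B>. x \<in> B \<and> card B = 4} = {X\<in>{B\<in>\<B>. card B = 4}. x \<in> X}" by auto
    then show ?thesis unfolding deg_def F by simp
  qed
  have pC: "p \<notin> C"
  proof
    assume "p \<in> C"
    then have "{X\<in>{A, B, C}. p \<in> X} = {A, B, C}" using p by auto
    then have "deg 4 p = 3" using F(2-) by (simp add: deg4_eq)
    moreover have "deg 4 p \<le> 2" using deg4 pq by blast
    ultimately show False by simp
  qed
  obtain u v w where u: "L - (A \<union> B) = {u, v, w}" "u \<noteq> v" "u \<noteq> w" "v \<noteq> w" "u \<in> C" "v \<in> C" "{p, u} \<in> \<B>"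
    using three_four_blocks_residual[OF F, of p] p deg4 pq by auto
  have F': "{B\<in>\<B>. card B = 4} = {C, B, A}" using F by auto
  have "deg 4 q \<le> 2" using deg4 pq by blast
  then obtain u' v' w' where u': "L - (C \<union> B) = {u', v', w'}" "u' \<in> A" "{q, u'} \<in> \<B>"
    using three_four_blocks_residual[OF F' F(3,2,4)[symmetric] q(2,1)] by metis
  have uL: "u \<in> L" "u \<notin> A" "u \<notin> B" "v \<in> L" "v \<notin> A" "v \<notin> B" "w \<in> L" "w \<notin> A" "w \<notin> B"
    using u by auto
  have uL': "u' \<in> L" "u' \<notin> B" "u' \<notin> C" using u' by auto
  have pu: "p \<noteq> u" "q \<noteq> u'" using p q uL uL' by auto
  let ?E = "{B\<in>\<B>. card B = 2}"
  have "num 2 = 3" using four_blocks_case(1)[OF deg4] .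
  then have cardE: "card ?E = 3" by (simp add: num_def)
  have finE: "finite ?E" by (simp add: finite_blocks)
  \<comment> \<open>An element in exactly one block of size four has an even number of double
    blocks, so one of them implies another.\<close>
  have more: "\<exists>T\<in>?E. x \<in> T \<and> T \<noteq> D" if x: "x \<in> L" "deg 4 x = 1" "D \<in> ?E" "x \<in> D" for x D
  proof -
    have "deg 2 x = 2 * (3 - deg 3 x)" using deg_eq[of x] x by auto
    moreover have "deg 2 x \<noteq> 0" using x deg_eq_0_iff by auto
    ultimately have "\<not> deg 2 x \<le> Suc 0" by presburger
    then obtain S T where "S \<in> \<B>" "x \<in> S" "card S = 2" "T \<in> \<B>" "x \<in> T" "card T = 2" "S \<noteq> T"
      unfolding deg_def by (subst (asm) card_le_Suc0_iff_eq) (auto simp: finite_blocks)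
    then show ?thesis by auto
  qed
  have "{X\<in>{A, B, C}. u \<in> X} = {C}" "{X\<in>{A, B, C}. u' \<in> X} = {A}" using uL uL' u u' by auto
  then have "deg 4 u = 1" "deg 4 u' = 1" by (simp_all add: deg4_eq)
  moreover have pE: "{p, u} \<in> ?E" "{q, u'} \<in> ?E" using u u' pu by auto
  ultimately obtain S T where S: "S \<in> ?E" "u \<in> S" "S \<noteq> {p, u}" and T: "T \<in> ?E" "u' \<in> T" "T \<noteq> {q, u'}"
    using more[of u "{p, u}"] more[of u' "{q, u'}"] uL uL' by blast
  have d: "u \<noteq> u'" "u \<noteq> q" "u' \<noteq> p" "p \<noteq> q" using uL uL' p q u u' pC by auto
  have ne: "S \<noteq> {q, u'}" "T \<noteq> {p, u}" "{p, u} \<noteq> {q, u'}" using S T d by auto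
  \<comment> \<open>Distinct \<open>S\<close> and \<open>T\<close> would make four double blocks
    together with the two known ones.\<close>
  have "S = T"
  proof (rule ccontr)
    assume "S \<noteq> T"
    then have "card {S, T, {p, u}, {q, u'}} = 4" using S(3) T(3) ne by auto
    moreover have "card {S, T, {p, u}, {q, u'}} \<le> card ?E"
      by (rule card_mono[OF finE]) (use S T pE in auto)
    ultimately show False using cardE by simp
  qed
  then have "card {u, u'} = card S" "{u, u'} \<subseteq> S" using S T d by auto
  moreover have "finite S" using S finite_block by auto
  ultimately have Seq: "S = {u, u'}" using card_subset_eq by metis
  have "card {{p, u}, {q, u'}, S} = 3" using S(3) ne by auto
  then have Eeq: "?E = {{p, u}, {q, u'}, S}"
    using card_subset_eq[OF finE, of "{{p, u}, {q, u'}, S}"] pE S cardE by auto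
  obtain R where R: "R \<in> \<B>" "p \<in> R" "v \<in> R" "R \<subseteq> insert p (L - (A \<union> B))" "card R \<le> 3"
    by (rule residual_block[of A B p v]) (use A F(2) p uL deg4 pq in auto)
  have vn: "v \<notin> {p, u, q, u'}" using p q uL uL' u u' by auto
  have "R \<notin> ?E" unfolding Eeq Seq using R vn by auto
  then have "card R = 3" using R block_card_ge[of R] by auto
  have "R \<noteq> C" using R pC by auto
  \<comment> \<open>\<open>R\<close> has three elements inside \<open>{p, u, v, w}\<close>; once
    \<open>u\<close> is excluded, it must be \<open>{p, v, w}\<close>. Then \<open>w\<close> is not
    in \<open>C\<close>, because \<open>R\<close> and \<open>C\<close> already share
    \<open>v\<close>.\<close>
  then have "u \<notin> R" using block_unique[of R C u v] u R A by auto
  have "w \<in> R"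
  proof (rule ccontr)
    assume "w \<notin> R"
    then have "R \<subseteq> {p, v}" using R u \<open>u \<notin> R\<close> by auto
    then have "card R \<le> card {p, v}" by (intro card_mono) auto
    then show False using \<open>card R = 3\<close> vn by auto
  qed
  then have wC: "w \<notin> C" using block_unique[of R C v w] R u A \<open>R \<noteq> C\<close> by auto
  then have "{X\<in>{A, B, C}. w \<in> X} = {}" using uL by auto
  then have "deg 4 w = 0" by (simp only: deg4_eq card.empty)
  then have "deg 2 w + 2 * deg 3 w = 9" using deg_eq[of w] uL by simp
  then have "deg 2 w \<noteq> 0" by presburger
  then obtain D where "D \<in> ?E" "w \<in> D" using deg_eq_0_iff by auto
  moreover have "w \<notin> {p, u, q, u'}" using p q uL wC u u' by auto
  ultimately show False unfolding Eeq Seq by auto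
qed

text \<open>A block of four disjoint from both others would require \<open>4 + 7\<close> elements,
  since those two cover at least seven. Hence each block meets another, and some block meets both
  others, which is the chain already excluded.\<close>

lemma not_three_four_blocks:
  assumes deg4: "\<forall>x\<in>L. deg 4 x \<le> 2" shows "num 4 \<noteq> 3"
proof
  assume "num 4 = 3"
  then obtain A B C where F: "{B\<in>\<B>. card B = 4} = {A, B, C}" "A \<noteq> B" "B \<noteq> C" "A \<noteq> C"
    unfolding num_def card_3_iff by blast
  have "A \<in> {B\<in>\<B>. card B = 4}" "B \<in> {B\<in>\<B>. card B = 4}" "C \<in> {B\<in>\<B>. card B = 4}"
    unfolding F by auto
  then have A: "A \<in> \<B>" "B \<in> \<B>" "C \<in> \<B>" "card A = 4" "card B = 4" "card C = 4" by auto
  have disj: "X \<inter> Y \<noteq> {} \<or> X \<inter> Z \<noteq> {}"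
    if X: "X \<in> \<B>" "Y \<in> \<B>" "Z \<in> \<B>" "card X = 4" "card Y = 4" "card Z = 4" "Y \<noteq> Z" for X Y Z
  proof (rule ccontr)
    assume "\<not> (X \<inter> Y \<noteq> {} \<or> X \<inter> Z \<noteq> {})"
    then have "X \<inter> (Y \<union> Z) = {}" by auto
    then have "card (X \<union> (Y \<union> Z)) = card X + card (Y \<union> Z)"
      using X finite_block by (intro card_Un_disjoint) auto
    moreover have "card (Y \<union> Z) + card (Z \<inter> Y) = 8"
      using X card_Un_Int[of Y Z] finite_block by (simp add: Int_commute)
    moreover have "card (Z \<inter> Y) \<le> 1" using X card_blocks_meet_le by blast
    moreover have "card (X \<union> (Y \<union> Z)) \<le> card L"
      using X block_subset finite_L by (intro card_mono) auto
    ultimately show False using X card_L by linarith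
  qed
  have perm: "{B\<in>\<B>. card B = 4} = {B, A, C}" "{B\<in>\<B>. card B = 4} = {A, C, B}" using F by auto
  note chain = three_four_blocks_chain[OF deg4]
  from disj[of A B C] disj[of B A C] disj[of C A B] A F
  consider "A \<inter> B \<noteq> {}" "B \<inter> C \<noteq> {}" | "A \<inter> B \<noteq> {}" "A \<inter> C \<noteq> {}" | "A \<inter> C \<noteq> {}" "B \<inter> C \<noteq> {}"
    by (auto simp: Int_commute)
  then show False
  proof cases
    case 1
    then obtain p q where "p \<in> A" "p \<in> B" "q \<in> B" "q \<in> C" by blast
    then show False using chain[OF F] by blast
  next
    case 2
    then obtain p q where "p \<in> B" "p \<in> A" "q \<in> A" "q \<in> C" by blast
    then show False using chain[OF perm(1) F(2)[symmetric] F(4,3)] by blast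
  next
    case 3
    then obtain p q where "p \<in> A" "p \<in> C" "q \<in> C" "q \<in> B" by blast
    then show False using chain[OF perm(2) F(4) F(3)[symmetric] F(2)] by blast
  qed
qed

text \<open>Outside \<open>P \<union> Q\<close> there are only \<open>e\<close>, \<open>f\<close>,
  \<open>g\<close>. The block from \<open>v\<close> to \<open>e\<close> avoids \<open>g\<close>,
  which shares \<open>R\<close> with \<open>e\<close>. It is not a double block, because
  \<open>deg 4 e = 1\<close> means \<open>deg 2 e = 0\<close>. So its third element is
  \<open>f\<close>.\<close>

lemma four_blocks_third:
  assumes deg4: "\<forall>x\<in>L. deg 4 x \<le> 2" and n: "num 4 = 4"
    and F: "{B\<in>\<B>. card B = 4} = {P, Q, R, S}" "P \<noteq> Q" "R \<noteq> S" "P \<noteq> R" "Q \<noteq> R"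
    and v: "v \<in> P" "v \<in> Q" and e: "e \<in> R" "e \<notin> P" "e \<notin> Q" "e \<notin> S"
    and f: "f \<in> S" "f \<notin> P" "f \<notin> Q" "f \<notin> R" and g: "g \<in> R" "g \<in> S" "g \<notin> P" "g \<notin> Q"
  shows "\<exists>T\<in>\<B>. {v, e, f} \<subseteq> T"
proof -
  have "P \<in> {B\<in>\<B>. card B = 4}" "Q \<in> {B\<in>\<B>. card B = 4}" "R \<in> {B\<in>\<B>. card B = 4}" "S \<in> {B\<in>\<B>. card B = 4}"
    unfolding F by auto
  then have A: "P \<in> \<B>" "Q \<in> \<B>" "R \<in> \<B>" "S \<in> \<B>" "card P = 4" "card Q = 4" "card R = 4" "card S = 4" by auto
  have L: "v \<in> L" "e \<in> L" "f \<in> L" "g \<in> L" using A v e f g block_subset by auto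
  obtain T where T: "T \<in> \<B>" "v \<in> T" "e \<in> T" "T \<subseteq> insert v (L - (P \<union> Q))" "card T \<le> 3"
    by (rule residual_block[of P Q v e]) (use A F(2) v e L deg4 in auto)
  have "{B\<in>\<B>. e \<in> B \<and> card B = 4} = {X\<in>{B\<in>\<B>. card B = 4}. e \<in> X}" by auto
  also have "\<dots> = {R}" unfolding F using e by auto
  finally have "deg 4 e = 1" by (simp add: deg_def)
  then have "deg 2 e = 0" using four_blocks_case(3)[OF deg4 n L(2)] by simp
  then have "card T \<noteq> 2" using T deg_eq_0_iff by auto
  then have T3: "card T = 3" using T block_card_ge[of T] by auto
  have "{e, f, g} \<subseteq> L - (P \<union> Q)" using e f g L by auto
  moreover have "e \<noteq> f" "e \<noteq> g" "f \<noteq> g" using e f g by auto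
  then have "card {e, f, g} = 3" by simp
  moreover have "card (L - (P \<union> Q)) = 3"
    by (rule card_residual[OF A(1,2) F(2) A(5,6) v])
  ultimately have Req: "L - (P \<union> Q) = {e, f, g}"
    using card_subset_eq[of "L - (P \<union> Q)" "{e, f, g}"] finite_L by simp
  have "v \<notin> R"
  proof
    assume "v \<in> R"
    then have "card {P, Q, R} \<le> deg 4 v" using A v by (intro deg_ge_card) auto
    moreover have "deg 4 v \<le> 2" using deg4 L by blast
    moreover have "card {P, Q, R} = 3" using F(2,4,5) by simp
    ultimately show False by simp
  qed
  then have "g \<notin> T" using block_unique[of T R e g] T A e g by auto
  have "f \<in> T"
  proof (rule ccontr)
    assume "f \<notin> T"
    then have "T \<subseteq> {v, e}" using T Req \<open>g \<notin> T\<close> by auto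
    then have "card T \<le> card {v, e}" by (intro card_mono) auto
    also have "\<dots> \<le> 2" by (simp add: card_insert_if)
    finally show False using T3 by simp
  qed
  then show ?thesis using T by auto
qed

text \<open>If \<open>P\<close> and \<open>Q\<close> were disjoint, two elements would remain, and
  each of \<open>R\<close>, \<open>S\<close> would need both of them to reach size four.\<close>

lemma four_blocks_meet:
  assumes F: "{B\<in>\<B>. card B = 4} = {P, Q, R, S}" "P \<noteq> R" "P \<noteq> S" "Q \<noteq> R" "Q \<noteq> S" "R \<noteq> S"
  shows "P \<inter> Q \<noteq> {}"
proof
  assume disj: "P \<inter> Q = {}"
  have "P \<in> {B\<in>\<B>. card B = 4}" "Q \<in> {B\<in>\<B>. card B = 4}" "R \<in> {B\<in>\<B>. card B = 4}" "S \<in> {B\<in>\<B>. card B = 4}"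
    unfolding F by auto
  then have A: "P \<in> \<B>" "Q \<in> \<B>" "R \<in> \<B>" "S \<in> \<B>" "card P = 4" "card Q = 4" "card R = 4" "card S = 4" by auto
  have fin: "finite P" "finite Q" using A finite_block by auto
  have sub: "P \<union> Q \<subseteq> L" using A block_subset by auto
  let ?R = "L - (P \<union> Q)"
  have "card (P \<union> Q) = 8" using disj fin A by (simp add: card_Un_disjoint)
  then have R2: "card ?R = 2" using sub fin card_L by (simp add: card_Diff_subset)
  have "?R \<subseteq> X" if X: "X \<in> \<B>" "card X = 4" "P \<noteq> X" "Q \<noteq> X" for X
  proof -
    have "X \<subseteq> (X \<inter> P) \<union> (X \<inter> Q) \<union> (X \<inter> ?R)" using X block_subset by auto
    then have "card X \<le> card ((X \<inter> P) \<union> (X \<inter> Q) \<union> (X \<inter> ?R))"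
      by (rule card_mono[rotated]) (use fin finite_L in auto)
    also have "\<dots> \<le> card ((X \<inter> P) \<union> (X \<inter> Q)) + card (X \<inter> ?R)" by (rule card_Un_le)
    also have "\<dots> \<le> card (X \<inter> P) + card (X \<inter> Q) + card (X \<inter> ?R)" by (simp add: card_Un_le)
    finally have "card ?R \<le> card (X \<inter> ?R)"
      using card_blocks_meet_le[of P X] card_blocks_meet_le[of Q X] A X R2 by fastforce
    then have "X \<inter> ?R = ?R" using finite_L by (intro card_seteq) auto
    then show ?thesis by auto
  qed
  then have "?R \<subseteq> S \<inter> R" using A F(2-) by auto
  then have "card ?R \<le> card (S \<inter> R)" using A finite_block by (intro card_mono) auto
  then show False using R2 card_blocks_meet_le[of R S] A F(6) by auto
qed

end

section \<open>Linear spaces represented over a field\<close>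

fun det3 :: "'f \<times> 'f \<times> 'f \<Rightarrow> 'f \<times> 'f \<times> 'f \<Rightarrow> 'f \<times> 'f \<times> 'f \<Rightarrow> 'f::comm_ring" where
  "det3 (a, b, c) (d, e, f) (g, h, i) = a * (e * i - f * h) - b * (d * i - f * g) + c * (d * h - e * g)"

text \<open>The linear map taking the standard basis to \<open>x\<close>, \<open>y\<close>,
  \<open>z\<close>. With this reading \<open>det3_comb3\<close> is multiplicativity of the
  determinant, and \<open>cramer\<close> provides the inverse map.\<close>

fun comb3 :: "'f \<times> 'f \<times> 'f \<Rightarrow> 'f \<times> 'f \<times> 'f \<Rightarrow> 'f \<times> 'f \<times> 'f \<Rightarrow> 'f \<times> 'f \<times> 'f \<Rightarrow> 'f \<times> 'f \<times> 'f::comm_ring" where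
  "comb3 (a, b, c) (d, e, f) (g, h, i) (r, s, t)
    = (r * a + s * d + t * g, r * b + s * e + t * h, r * c + s * f + t * i)"

lemma det3_comb3: "det3 (comb3 x y z u) (comb3 x y z v) (comb3 x y z w) = det3 x y z * det3 u v w"
  by (cases x; cases y; cases z; cases u; cases v; cases w) (simp add: algebra_simps)

lemma cramer:
  fixes x y z u :: "'f::field \<times> 'f \<times> 'f"
  assumes "det3 x y z \<noteq> 0"
  shows "comb3 x y z (det3 u y z / det3 x y z, det3 x u z / det3 x y z, det3 x y u / det3 x y z) = u"
proof -
  obtain a b c d e f g h i r s t where [simp]: "x = (a, b, c)" "y = (d, e, f)" "z = (g, h, i)" "u = (r, s, t)"
    by (metis prod_cases3)
  show ?thesis
    using assms by (simp add: add_divide_distrib[symmetric] nonzero_divide_eq_eq) (simp add: algebra_simps)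
qed

text \<open>Blocks are exactly the dependencies among three vectors. That two vectors are not
  proportional is expressed by completing them to a nonzero determinant, so every condition is about
  \<open>det3\<close> and survives a change of basis. The type class allows cancelling 2 and
  3.\<close>

locale represented_space = linear_space L \<B> for L :: "'a set" and \<B> +
  fixes v :: "'a \<Rightarrow> 'f::field_char_0 \<times> 'f \<times> 'f"
  assumes det_block: "B \<in> \<B> \<Longrightarrow> x \<in> B \<Longrightarrow> y \<in> B \<Longrightarrow> z \<in> B \<Longrightarrow> det3 (v x) (v y) (v z) = 0"
    and block_det: "x \<in> L \<Longrightarrow> y \<in> L \<Longrightarrow> z \<in> L \<Longrightarrow> x \<noteq> y \<Longrightarrow> x \<noteq> z \<Longrightarrow> y \<noteq> z
      \<Longrightarrow> det3 (v x) (v y) (v z) = 0 \<Longrightarrow> \<exists>B\<in>\<B>. {x, y, z} \<subseteq> B"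
    and independent: "x \<in> L \<Longrightarrow> y \<in> L \<Longrightarrow> x \<noteq> y \<Longrightarrow> \<exists>w. det3 (v x) (v y) w \<noteq> 0"
begin

text \<open>In the new basis every determinant changes by the same nonzero factor \<open>?d\<close>,
  so the three representation conditions carry over.\<close>

lemma frame:
  assumes "x \<in> L" "y \<in> L" "z \<in> L" "x \<noteq> y" "x \<noteq> z" "y \<noteq> z" "\<And>B. B \<in> \<B> \<Longrightarrow> \<not> {x, y, z} \<subseteq> B"
  obtains v' where "represented_space L \<B> v'"
    "v' x = (1, 0, 0 :: 'f)" "v' y = (0, 1, 0)" "v' z = (0, 0, 1)"
proof -
  let ?d = "det3 (v x) (v y) (v z)"
  have d: "?d \<noteq> 0" using block_det[of x y z] assms by blast
  define f where "f u = (det3 u (v y) (v z) / ?d, det3 (v x) u (v z) / ?d, det3 (v x) (v y) u / ?d)" for u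
  have "comb3 (v x) (v y) (v z) (f u) = u" for u
    unfolding f_def by (rule cramer[OF d])
  then have det_f: "det3 u1 u2 u3 = ?d * det3 (f u1) (f u2) (f u3)" for u1 u2 u3
    by (metis det3_comb3)
  have "represented_space L \<B> (f \<circ> v)"
  proof
    show "det3 ((f \<circ> v) a) ((f \<circ> v) b) ((f \<circ> v) c) = 0"
      if "B \<in> \<B>" "a \<in> B" "b \<in> B" "c \<in> B" for B a b c
      using det_block[OF that] d det_f[of "v a" "v b" "v c"] by simp
    show "\<exists>B\<in>\<B>. {a, b, c} \<subseteq> B" if "a \<in> L" "b \<in> L" "c \<in> L" "a \<noteq> b" "a \<noteq> c" "b \<noteq> c"
      "det3 ((f \<circ> v) a) ((f \<circ> v) b) ((f \<circ> v) c) = 0" for a b c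
      using block_det[of a b c] that d det_f[of "v a" "v b" "v c"] by simp
    show "\<exists>w. det3 ((f \<circ> v) a) ((f \<circ> v) b) w \<noteq> 0" if "a \<in> L" "b \<in> L" "a \<noteq> b" for a b
      using independent[OF that] d det_f[of "v a" "v b"] by fastforce
  qed
  moreover have "det3 a a b = 0" "det3 a b a = 0" "det3 b a a = 0" for a b :: "'f \<times> 'f \<times> 'f"
    by (cases a; cases b; simp add: algebra_simps)+
  then have "(f \<circ> v) x = (1, 0, 0)" "(f \<circ> v) y = (0, 1, 0)" "(f \<circ> v) z = (0, 0, 1)"
    using d by (simp_all add: f_def)
  ultimately show thesis by (rule that)
qed

section \<open>Linear spaces that have no representation in characteristic zero\<close>

lemma vec_nonzero:
  assumes "x \<in> L" "y \<in> L" "x \<noteq> y" shows "v x \<noteq> (0, 0, 0)"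
proof
  assume "v x = (0, 0, 0)"
  moreover have "det3 (0, 0, 0) u w = 0" for u w :: "'f \<times> 'f \<times> 'f"
    by (cases u; cases w) simp
  ultimately show False using independent[OF assms] by simp
qed

text \<open>With \<open>a\<close>, \<open>b\<close>, \<open>c\<close> as basis, the three blocks
  through \<open>g\<close> give Ceva's condition for \<open>d\<close>, \<open>e\<close>,
  \<open>f\<close>, whereas the block \<open>{d, e, f}\<close> gives Menelaus' condition. The two
  differ by a sign, so twice a nonzero product vanishes.\<close>

lemma not_fano:
  assumes "card L = 7" shows "\<exists>B\<in>\<B>. card B \<noteq> 3"
proof (rule ccontr)
  assume "\<not> ?thesis"
  then have three: "card B = 3" if "B \<in> \<B>" for B using that by blast
  have join: "\<exists>z. {x, y, z} \<in> \<B> \<and> z \<noteq> x \<and> z \<noteq> y" if xy: "x \<in> L" "y \<in> L" "x \<noteq> y" for x y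
  proof -
    obtain B where B: "B \<in> \<B>" "x \<in> B" "y \<in> B" using block_exists xy by blast
    have "card (B - {x, y}) = 1"
      using B xy three finite_block by (simp add: card_Diff_subset)
    then obtain z where "B - {x, y} = {z}" by (auto simp: card_1_singleton_iff)
    then have "B = {x, y, z}" "z \<noteq> x" "z \<noteq> y" using B by auto
    then show ?thesis using B by auto
  qed
  have uniq: "B = C" if "B \<in> \<B>" "C \<in> \<B>" "{x, y} \<subseteq> B \<inter> C" "x \<noteq> y" for B C x y
    using block_unique that by auto
  have on_both: "p \<in> C" if "B \<in> \<B>" "C \<in> \<B>" "x \<in> B" "x \<in> C" "y \<in> B" "y \<in> C" "x \<noteq> y" "p \<in> B" for B C x y p
    using block_unique that by blast
  obtain a b where ab: "a \<in> L" "b \<in> L" "a \<noteq> b"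
  proof -
    have "\<not> card L \<le> Suc 0" using assms by simp
    then show thesis using that card_le_Suc0_iff_eq[OF finite_L] by blast
  qed
  obtain d where d: "{a, b, d} \<in> \<B>" "d \<noteq> a" "d \<noteq> b" using join[OF ab] by blast
  have "\<not> L \<subseteq> {a, b, d}" using card_mono[of "{a, b, d}" L] assms three[OF d(1)] by auto
  then obtain c where c: "c \<in> L" "c \<noteq> a" "c \<noteq> b" "c \<noteq> d" by auto
  obtain e where e: "{a, c, e} \<in> \<B>" "e \<noteq> a" "e \<noteq> c" using join[OF ab(1) c(1)] c by blast
  obtain f where f: "{b, c, f} \<in> \<B>" "f \<noteq> b" "f \<noteq> c" using join[OF ab(2) c(1)] c by blast
  have L1: "d \<in> L" "e \<in> L" "f \<in> L" using d e f block_subset by auto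
  have eb: "e \<noteq> b" using uniq[OF d(1) e(1), of a b] c ab by auto
  have ed: "e \<noteq> d" using uniq[OF d(1) e(1), of a d] d c by auto
  have fa: "f \<noteq> a" using uniq[OF d(1) f(1), of a b] c ab by auto
  have fd: "f \<noteq> d" using uniq[OF d(1) f(1), of b d] d c by auto
  have fe: "f \<noteq> e"
  proof
    assume "f = e"
    then have "{a, c, e} = {b, c, f}" using uniq[OF e(1) f(1), of c e] e by simp
    then have "a \<in> {b, c, f}" by blast
    then show False using ab c fa by simp
  qed
  note ne = ab(3) d(2,3) c(2-4) e(2,3) f(2,3) eb ed fa fd fe
  have "card {a, b, c, d, e, f} = 6" using ne by auto
  then have "\<not> L \<subseteq> {a, b, c, d, e, f}" using card_mono[of "{a, b, c, d, e, f}" L] assms by auto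
  then obtain g where g: "g \<in> L" "g \<notin> {a, b, c, d, e, f}" by blast
  note in7 = ab(1,2) c(1) L1 g(1)
  have "card {a, b, c, d, e, f, g} = 7" using ne g by auto
  then have L: "L = {a, b, c, d, e, f, g}"
    using card_subset_eq[OF finite_L, of "{a, b, c, d, e, f, g}"] assms in7 by simp
  \<comment> \<open>The third element of each remaining block is found by exclusion: any wrong
    candidate would make the block share two elements with a different known block.\<close>
  obtain g1 where g1: "{a, f, g1} \<in> \<B>" "g1 \<noteq> a" "g1 \<noteq> f" using join[OF in7(1) in7(6)] ne by metis
  have "g1 \<in> L" using g1 block_subset by auto
  moreover have "g1 \<noteq> b" using on_both[OF g1(1) d(1), of a b f] ne by auto
  moreover have "g1 \<noteq> c" using on_both[OF g1(1) e(1), of a c f] ne by auto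
  moreover have "g1 \<noteq> d" using on_both[OF g1(1) d(1), of a d f] ne by auto
  moreover have "g1 \<noteq> e" using on_both[OF g1(1) e(1), of a e f] ne by auto
  ultimately have afg: "{a, f, g} \<in> \<B>" using g1 L by auto
  obtain g2 where g2: "{b, e, g2} \<in> \<B>" "g2 \<noteq> b" "g2 \<noteq> e" using join[OF in7(2) in7(5)] ne by metis
  have "g2 \<in> L" using g2 block_subset by auto
  moreover have "g2 \<noteq> a" using on_both[OF g2(1) d(1), of a b e] ne by auto
  moreover have "g2 \<noteq> c" using on_both[OF g2(1) f(1), of b c e] ne by auto
  moreover have "g2 \<noteq> d" using on_both[OF g2(1) d(1), of b d e] ne by auto
  moreover have "g2 \<noteq> f" using on_both[OF g2(1) f(1), of b f e] ne by auto
  ultimately have beg: "{b, e, g} \<in> \<B>" using g2 L by auto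
  obtain g3 where g3: "{c, d, g3} \<in> \<B>" "g3 \<noteq> c" "g3 \<noteq> d" using join[OF in7(3) in7(4)] ne by metis
  have "g3 \<in> L" using g3 block_subset by auto
  moreover have "g3 \<noteq> a" using on_both[OF g3(1) e(1), of a c d] ne by auto
  moreover have "g3 \<noteq> b" using on_both[OF g3(1) f(1), of b c d] ne by auto
  moreover have "g3 \<noteq> e" using on_both[OF g3(1) e(1), of c e d] ne by auto
  moreover have "g3 \<noteq> f" using on_both[OF g3(1) f(1), of c f d] ne by auto
  ultimately have cdg: "{c, d, g} \<in> \<B>" using g3 L by auto
  obtain g4 where g4: "{d, e, g4} \<in> \<B>" "g4 \<noteq> d" "g4 \<noteq> e" using join[OF in7(4) in7(5)] ne by metis
  have "g4 \<in> L" using g4 block_subset by auto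
  moreover have "g4 \<noteq> a" using on_both[OF g4(1) d(1), of a d e] ne by auto
  moreover have "g4 \<noteq> b" using on_both[OF g4(1) d(1), of b d e] ne by auto
  moreover have "g4 \<noteq> c" using on_both[OF g4(1) e(1), of c e d] ne by auto
  moreover have "g4 \<noteq> g" using on_both[OF g4(1) cdg, of d g e] ne g by auto
  ultimately have deF: "{d, e, f} \<in> \<B>" using g4 L by auto
  have nb: "\<not> {a, b, c} \<subseteq> B" if "B \<in> \<B>" for B
    using uniq[OF that d(1), of a b] ne by auto
  obtain u where u: "represented_space L \<B> u" "u a = (1, 0, 0 :: 'f)" "u b = (0, 1, 0)" "u c = (0, 0, 1)"
    using frame[OF ab(1,2) c(1) ab(3) c(2)[symmetric] c(3)[symmetric] nb] by blast
  interpret u: represented_space L \<B> u by (rule u)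
  obtain d1 d2 d3 e1 e2 e3 f1 f2 f3 g1 g2 g3 where
    vec: "u d = (d1, d2, d3)" "u e = (e1, e2, e3)" "u f = (f1, f2, f3)" "u g = (g1, g2, g3)"
    by (metis prod_cases3)
  have zero: "d3 = 0" "e2 = 0" "f1 = 0"
    using u.det_block[OF d(1), of a b d] u.det_block[OF e(1), of a c e] u.det_block[OF f(1), of b c f]
    by (simp_all add: u vec)
  have eqs: "f2 * g3 = f3 * g2" "e3 * g1 = e1 * g3" "d1 * g2 = d2 * g1" "- (d1 * (e3 * f2)) = d2 * (e1 * f3)"
    using u.det_block[OF afg, of a f g] u.det_block[OF beg, of b e g] u.det_block[OF cdg, of c d g]
      u.det_block[OF deF, of d e f]
    by (simp_all add: u vec zero algebra_simps)
  have nz: "d1 \<noteq> 0" "d2 \<noteq> 0" "e1 \<noteq> 0" "e3 \<noteq> 0" "f2 \<noteq> 0" "f3 \<noteq> 0"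
    using u.independent[of b d] u.independent[of a d] u.independent[of a e] u.independent[of c e]
      u.independent[of b f] u.independent[of c f] L ne by (auto simp: u vec zero)
  \<comment> \<open>The first three equations link the coordinates of \<open>u g\<close> by nonzero
    factors, so if one of them vanished the whole vector would.\<close>
  have "g1 \<noteq> 0 \<and> g2 \<noteq> 0 \<and> g3 \<noteq> 0"
    using eqs(1-3) nz u.vec_nonzero[of g a] L g by (auto simp: vec)
  moreover have "d1 * e3 * f2 * (g1 * g2 * g3) = d2 * e1 * f3 * (g1 * g2 * g3)"
    using eqs(1-3) by Groebner_Basis.algebra
  ultimately have "d1 * e3 * f2 = d2 * e1 * f3" by simp
  then have "2 * (d1 * e3 * f2) = 0" using eqs(4) by Groebner_Basis.algebra
  then show False using nz by simp
qed

text \<open>Dually, the \<open>A\<^sub>i\<close> are four lines in general position with six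
  crossings, and \<open>ei\<close> is a further point on the \<open>i\<close>-th. On the triangle
  \<open>v23\<close>, \<open>v13\<close>, \<open>v12\<close>, points \<open>(0, 1, p)\<close>,
  \<open>(q, 0, 1)\<close>, \<open>(1, r, 0)\<close> on the sides are collinear iff
  \<open>p * q * r = -1\<close>. The four such transversals not involving \<open>e4\<close> force
  \<open>s = - p\<close> and \<open>t = - q\<close>; the conditions on \<open>e4\<close> then
  produce the factor 3.\<close>

lemma no_quadrangle:
  assumes A: "A\<^sub>1 \<in> \<B>" "A\<^sub>2 \<in> \<B>" "A\<^sub>3 \<in> \<B>" "A\<^sub>4 \<in> \<B>"
    "{v12, v13, v14, e1} \<subseteq> A\<^sub>1" "{v12, v23, v24, e2} \<subseteq> A\<^sub>2"
    "{v13, v23, v34, e3} \<subseteq> A\<^sub>3" "{v14, v24, v34, e4} \<subseteq> A\<^sub>4"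
    and T: "\<exists>T\<in>\<B>. {v12, e3, e4} \<subseteq> T" "\<exists>T\<in>\<B>. {v13, e2, e4} \<subseteq> T" "\<exists>T\<in>\<B>. {v14, e2, e3} \<subseteq> T"
    "\<exists>T\<in>\<B>. {v23, e1, e4} \<subseteq> T" "\<exists>T\<in>\<B>. {v24, e1, e3} \<subseteq> T" "\<exists>T\<in>\<B>. {v34, e1, e2} \<subseteq> T"
    and dist: "distinct [v12, v13, v14, e1]" "distinct [v12, v23, v24, e2]" "distinct [v13, v23, v34, e3]"
    "v14 \<noteq> e4"
    and free: "\<And>B. B \<in> \<B> \<Longrightarrow> \<not> {v12, v13, v23} \<subseteq> B"
  shows False
proof -
  have inL: "v12 \<in> L" "v13 \<in> L" "v14 \<in> L" "e1 \<in> L" "v23 \<in> L" "v24 \<in> L" "e2 \<in> L"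
    "v34 \<in> L" "e3 \<in> L" "e4 \<in> L"
    using A block_subset by auto
  have "\<And>B. B \<in> \<B> \<Longrightarrow> \<not> {v23, v13, v12} \<subseteq> B" using free by (simp add: insert_commute)
  then obtain w where w: "represented_space L \<B> w" "w v23 = (1, 0, 0 :: 'f)" "w v13 = (0, 1, 0)" "w v12 = (0, 0, 1)"
    using frame[of v23 v13 v12] inL dist by auto
  interpret w: represented_space L \<B> w by (rule w)
  have first: "\<exists>b p. w y = (0, b, b * p) \<and> b \<noteq> 0 \<and> p \<noteq> 0" if y: "y \<in> A\<^sub>1" "y \<noteq> v12" "y \<noteq> v13" for y
  proof -
    obtain a b c where [simp]: "w y = (a, b, c)" by (metis prod_cases3)
    have yL: "y \<in> L" using y A block_subset by auto
    have "a = 0" using w.det_block[of "A\<^sub>1" v12 v13 y] A y by (simp add: w)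
    moreover have "b \<noteq> 0" "c \<noteq> 0"
      using w.independent[OF inL(1) yL] w.independent[OF inL(2) yL] y \<open>a = 0\<close> by (auto simp: w)
    ultimately show ?thesis by (intro exI[of _ b] exI[of _ "c / b"]) simp
  qed
  have second: "\<exists>c q. w y = (c * q, 0, c) \<and> c \<noteq> 0 \<and> q \<noteq> 0" if y: "y \<in> A\<^sub>2" "y \<noteq> v12" "y \<noteq> v23" for y
  proof -
    obtain a b c where [simp]: "w y = (a, b, c)" by (metis prod_cases3)
    have yL: "y \<in> L" using y A block_subset by auto
    have "b = 0" using w.det_block[of "A\<^sub>2" v12 v23 y] A y by (simp add: w)
    moreover have "a \<noteq> 0" "c \<noteq> 0"
      using w.independent[OF inL(1) yL] w.independent[OF inL(5) yL] y \<open>b = 0\<close> by (auto simp: w)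
    ultimately show ?thesis by (intro exI[of _ c] exI[of _ "a / c"]) simp
  qed
  have third: "\<exists>a r. w y = (a, a * r, 0) \<and> a \<noteq> 0 \<and> r \<noteq> 0" if y: "y \<in> A\<^sub>3" "y \<noteq> v13" "y \<noteq> v23" for y
  proof -
    obtain a b c where [simp]: "w y = (a, b, c)" by (metis prod_cases3)
    have yL: "y \<in> L" using y A block_subset by auto
    have "c = 0" using w.det_block[of "A\<^sub>3" v13 v23 y] A y by (simp add: w)
    moreover have "a \<noteq> 0" "b \<noteq> 0"
      using w.independent[OF inL(2) yL] w.independent[OF inL(5) yL] y \<open>c = 0\<close> by (auto simp: w)
    ultimately show ?thesis by (intro exI[of _ a] exI[of _ "b / a"]) simp
  qed
  obtain b p where v14: "w v14 = (0, b, b * p)" "b \<noteq> 0" "p \<noteq> 0" using first[of v14] A dist by auto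
  obtain f s where e1: "w e1 = (0, f, f * s)" "f \<noteq> 0" "s \<noteq> 0" using first[of e1] A dist by auto
  obtain c q where v24: "w v24 = (c * q, 0, c)" "c \<noteq> 0" "q \<noteq> 0" using second[of v24] A dist by auto
  obtain k t where e2: "w e2 = (k * t, 0, k)" "k \<noteq> 0" "t \<noteq> 0" using second[of e2] A dist by auto
  obtain a r where v34: "w v34 = (a, a * r, 0)" "a \<noteq> 0" "r \<noteq> 0" using third[of v34] A dist by auto
  obtain l u where e3: "w e3 = (l, l * u, 0)" "l \<noteq> 0" "u \<noteq> 0" using third[of e3] A dist by auto
  obtain x y z where e4: "w e4 = (x, y, z)" by (metis prod_cases3)
  note vec = v14(1) v24(1) v34(1) e1(1) e2(1) e3(1) e4 w(2-4)
  note nz = v14(2-) v24(2-) v34(2-) e1(2-) e2(2-) e3(2-)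
  have T0: "det3 (w i) (w j) (w m) = 0" if "\<exists>T\<in>\<B>. {i, j, m} \<subseteq> T" for i j m
    using that w.det_block by auto
  have T4: "det3 (w v14) (w v24) (w v34) = 0" "det3 (w v14) (w v24) (w e4) = 0"
    using w.det_block[of A\<^sub>4] A by auto
  have "b * c * a * (1 + p * q * r) = 0"
    using T4(1) unfolding vec det3.simps by Groebner_Basis.algebra
  then have 0: "p * q * r = - 1" using nz by (simp add: eq_neg_iff_add_eq_0 add.commute)
  have "f * k * a * (1 + s * t * r) = 0"
    using T0[OF T(6)] unfolding vec det3.simps by Groebner_Basis.algebra
  then have 1: "s * t * r = - 1" using nz by (simp add: eq_neg_iff_add_eq_0 add.commute)
  have "b * k * l * (1 + p * t * u) = 0"
    using T0[OF T(3)] unfolding vec det3.simps by Groebner_Basis.algebra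
  then have 2: "p * t * u = - 1" using nz by (simp add: eq_neg_iff_add_eq_0 add.commute)
  have "c * f * l * (1 + s * q * u) = 0"
    using T0[OF T(5)] unfolding vec det3.simps by Groebner_Basis.algebra
  then have 3: "s * q * u = - 1" using nz by (simp add: eq_neg_iff_add_eq_0 add.commute)
  have "f * (z - s * y) = 0" using T0[OF T(4)] unfolding vec det3.simps by Groebner_Basis.algebra
  then have z: "z = s * y" using nz by simp
  have "k * (x - t * z) = 0" using T0[OF T(2)] unfolding vec det3.simps by Groebner_Basis.algebra
  then have x: "x = t * z" using nz by simp
  have "c * b * (x - q * z + p * q * y) = 0"
    using T4(2) unfolding vec det3.simps by Groebner_Basis.algebra
  then have 4: "x - q * z + p * q * y = 0" using nz by simp
  have "s \<noteq> p" using w.independent[OF inL(3,4)] dist by (auto simp: vec algebra_simps)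
  moreover have "s * t = p * q" using 0 1 nz by (metis mult_right_cancel)
  \<comment> \<open>Multiplying the four Menelaus equations in pairs leaves the same factor
    \<open>t * r * q * u\<close> on both sides.\<close>
  moreover have "s * s = p * p"
  proof -
    have "(s * t * r) * (s * q * u) = (p * q * r) * (p * t * u)" using 0 1 2 3 by simp
    then have "(s * s) * (t * r * q * u) = (p * p) * (t * r * q * u)" by (simp add: mult_ac)
    then show ?thesis using nz by simp
  qed
  ultimately have s: "s = - p" and "s * t = p * q"
    by (auto simp: square_eq_iff)
  then have "p * (t + q) = 0" by Groebner_Basis.algebra
  then have t: "t = - q" using nz by (simp add: eq_neg_iff_add_eq_0)
  \<comment> \<open>After the substitutions each of the three terms of the equation equals
    \<open>p * q * y\<close>.\<close>
  have "3 * (p * q * y) = 0" using 4 by (simp add: x z s t algebra_simps)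
  then have "y = 0" using nz by simp
  then show False using w.vec_nonzero[OF inL(10,3)] dist by (auto simp: e4 x z)
qed

text \<open>With \<open>x\<close> sent to infinity the three blocks become parallel lines, and
  projection from \<open>r\<close> maps \<open>A\<^sub>1\<close> to \<open>A\<^sub>3\<close> by the
  translation \<open>\<rho> * Y r\<close>. Both \<open>q\<close> and \<open>q'\<close> induce
  bijections, so comparing the sums of coordinates gives equal translations:
  \<open>card (A\<^sub>1 - {x})\<close> is nonzero in characteristic zero. Then \<open>q\<close> and
  \<open>q'\<close> have proportional vectors.\<close>

lemma no_three_parallel_classes:
  assumes A: "A\<^sub>1 \<in> \<B>" "A\<^sub>2 \<in> \<B>" "A\<^sub>3 \<in> \<B>" "A\<^sub>1 \<noteq> A\<^sub>2" "A\<^sub>1 \<noteq> A\<^sub>3" "A\<^sub>2 \<noteq> A\<^sub>3"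
      "x \<in> A\<^sub>1" "x \<in> A\<^sub>2" "x \<in> A\<^sub>3" "card A\<^sub>1 = card A\<^sub>3"
    and q: "q \<in> A\<^sub>2 - {x}" "q' \<in> A\<^sub>2 - {x}" "q \<noteq> q'"
    and third: "\<And>p r. r \<in> {q, q'} \<Longrightarrow> p \<in> A\<^sub>1 - {x} \<Longrightarrow> \<exists>B\<in>\<B>. \<exists>s\<in>A\<^sub>3 - {x}. {p, r, s} \<subseteq> B"
  shows False
proof -
  note meet = blocks_meet_singleton[OF A(1,2,4,7,8)] blocks_meet_singleton[OF A(1,3,5,7,9)]
    blocks_meet_singleton[OF A(2,3,6,8,9)]
  have fin: "finite A\<^sub>1" "finite A\<^sub>3" using A finite_block by auto
  have subL: "A\<^sub>1 \<subseteq> L" "A\<^sub>2 \<subseteq> L" "A\<^sub>3 \<subseteq> L" using A block_subset by auto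
  have pos: "0 < card (A\<^sub>1 - {x})" using fin(1) A(7) block_card_ge[OF A(1)] by simp
  then obtain p0 where p0: "p0 \<in> A\<^sub>1 - {x}" by (metis card_gt_0_iff ex_in_conv)
  have "\<not> {x, p0, q} \<subseteq> B" if "B \<in> \<B>" for B
    using block_unique[OF that A(1), of x p0] p0 q A(7) meet(1) by auto
  moreover have "x \<in> L" "p0 \<in> L" "q \<in> L" "x \<noteq> p0" "x \<noteq> q" "p0 \<noteq> q"
    using p0 q(1) subL A(7) meet(1) by auto
  ultimately obtain w where w: "represented_space L \<B> w" "w x = (1, 0, 0 :: 'f)" "w p0 = (0, 1, 0)" "w q = (0, 0, 1)"
    using frame[of x p0 q] by blast
  interpret w: represented_space L \<B> w by (rule w)
  have xL: "x \<in> L" using subL A by auto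
  \<comment> \<open>\<open>X\<close> is used only on \<open>A\<^sub>1 - {x}\<close> and
    \<open>A\<^sub>3 - {x}\<close>, and \<open>Y\<close> only on \<open>A\<^sub>2 - {x}\<close>; the
    denominators are nonzero there.\<close>
  define X where "X y = (case w y of (a, b, c) \<Rightarrow> a / b)" for y
  define Y where "Y y = (case w y of (a, b, c) \<Rightarrow> a / c)" for y
  have vec1: "\<exists>b. w y = (X y * b, b, 0) \<and> b \<noteq> 0" if y: "y \<in> A\<^sub>1 - {x}" for y
  proof -
    obtain a b c where [simp]: "w y = (a, b, c)" by (metis prod_cases3)
    have "c = 0" using w.det_block[of "A\<^sub>1" x p0 y] A y p0 by (simp add: w)
    moreover have "b \<noteq> 0" using w.independent[OF xL, of y] y subL \<open>c = 0\<close> by (auto simp: w)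
    ultimately show ?thesis by (simp add: X_def)
  qed
  have vec2: "\<exists>c. w y = (Y y * c, 0, c) \<and> c \<noteq> 0" if y: "y \<in> A\<^sub>2 - {x}" for y
  proof -
    obtain a b c where [simp]: "w y = (a, b, c)" by (metis prod_cases3)
    have "b = 0" using w.det_block[of "A\<^sub>2" x q y] A y q by (simp add: w)
    moreover have "c \<noteq> 0" using w.independent[OF xL, of y] y subL \<open>b = 0\<close> by (auto simp: w)
    ultimately show ?thesis by (simp add: Y_def)
  qed
  have nz3: "b \<noteq> 0 \<and> c \<noteq> 0" if y: "y \<in> A\<^sub>3 - {x}" "w y = (a, b, c)" for y a b c
  proof -
    have nb: "\<not> {x, p0, y} \<subseteq> B" "\<not> {x, q, y} \<subseteq> B" if "B \<in> \<B>" for B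
      using block_unique[OF that A(3), of x y] p0 q(1) y meet A(9) by auto
    have "y \<in> L" "p0 \<in> L" "q \<in> L" "x \<noteq> p0" "x \<noteq> q" "x \<noteq> y" "p0 \<noteq> y" "q \<noteq> y"
      using y(1) p0 q(1) subL meet by auto
    then have "det3 (w x) (w p0) (w y) \<noteq> 0" "det3 (w x) (w q) (w y) \<noteq> 0"
      using w.block_det[of x p0 y] w.block_det[of x q y] xL nb by blast+
    then show ?thesis by (simp add: w y)
  qed
  obtain r0 where r0: "r0 \<in> A\<^sub>3 - {x}" using third[of q p0] p0 by auto
  obtain a0 b0 c0 where w0: "w r0 = (a0, b0, c0)" by (metis prod_cases3)
  \<comment> \<open>The vectors of \<open>A\<^sub>3\<close> lie in one plane containing the first
    basis vector, so the ratio of the last two coordinates is constant on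
    \<open>A\<^sub>3 - {x}\<close>; \<open>r0\<close> is an arbitrary sample.\<close>
  define \<rho> where "\<rho> = c0 / b0"
  have rho: "\<rho> \<noteq> 0" using nz3[OF r0 w0] by (simp add: \<rho>_def)
  have vec3: "\<exists>b. w y = (X y * b, b, \<rho> * b) \<and> b \<noteq> 0" if y: "y \<in> A\<^sub>3 - {x}" for y
  proof -
    obtain a b c where wy: "w y = (a, b, c)" by (metis prod_cases3)
    have "b0 * c = c0 * b" using w.det_block[of "A\<^sub>3" x r0 y] A y r0 by (simp add: w w0 wy)
    then have "c = \<rho> * b" using nz3[OF r0 w0] by (simp add: \<rho>_def field_simps)
    then show ?thesis using nz3[OF y wy] by (simp add: X_def wy)
  qed
  have eq: "X s = X p + \<rho> * Y r"
    if ps: "p \<in> A\<^sub>1 - {x}" "r \<in> A\<^sub>2 - {x}" "s \<in> A\<^sub>3 - {x}" "B \<in> \<B>" "{p, r, s} \<subseteq> B" for p r s B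
  proof -
    obtain b c d where v: "w p = (X p * b, b, 0)" "b \<noteq> 0" "w r = (Y r * c, 0, c)" "c \<noteq> 0"
      "w s = (X s * d, d, \<rho> * d)" "d \<noteq> 0"
      using vec1[OF ps(1)] vec2[OF ps(2)] vec3[OF ps(3)] by blast
    have "det3 (w p) (w r) (w s) = 0"
      using w.det_block[OF ps(4), of p r s] ps(5) by simp
    then have "b * c * d * (X s - X p - \<rho> * Y r) = 0"
      unfolding v det3.simps by Groebner_Basis.algebra
    then have "X s - X p - \<rho> * Y r = 0" using v(2,4,6) by simp
    then show ?thesis by (simp add: algebra_simps)
  qed
  have sums: "(\<Sum>s\<in>A\<^sub>3 - {x}. X s) = (\<Sum>p\<in>A\<^sub>1 - {x}. X p) + of_nat (card (A\<^sub>1 - {x})) * (\<rho> * Y r)"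
    if r: "r \<in> {q, q'}" for r
  proof -
    have r2: "r \<in> A\<^sub>2 - {x}" using r q by auto
    have "\<exists>s. s \<in> A\<^sub>3 - {x} \<and> (\<exists>B\<in>\<B>. {p, r, s} \<subseteq> B)" if "p \<in> A\<^sub>1 - {x}" for p
      using third[OF r that] by (elim bexE) (intro exI conjI bexI)
    then have "\<forall>p\<in>A\<^sub>1 - {x}. \<exists>s. s \<in> A\<^sub>3 - {x} \<and> (\<exists>B\<in>\<B>. {p, r, s} \<subseteq> B)" ..
    from bchoice[OF this] obtain h where
      h: "\<And>p. p \<in> A\<^sub>1 - {x} \<Longrightarrow> h p \<in> A\<^sub>3 - {x} \<and> (\<exists>B\<in>\<B>. {p, r, h p} \<subseteq> B)"
      by (elim exE) (rule that, erule bspec)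
    have inj: "inj_on h (A\<^sub>1 - {x})"
    proof (rule inj_onI, rule ccontr)
      fix p p' assume p: "p \<in> A\<^sub>1 - {x}" "p' \<in> A\<^sub>1 - {x}" "h p = h p'" "p \<noteq> p'"
      obtain B B' where B: "B \<in> \<B>" "{p, r, h p} \<subseteq> B" "B' \<in> \<B>" "{p', r, h p} \<subseteq> B'"
        using h[OF p(1)] h[OF p(2)] p(3) by auto
      have "r \<noteq> h p" using h[OF p(1)] r2 meet by auto
      then have "B = B'" using block_unique[of B B' r "h p"] B by auto
      then have "B = A\<^sub>1" using block_unique[of B A\<^sub>1 p p'] B p A by auto
      then show False using B r2 meet by auto
    qed
    \<comment> \<open>An injection between finite sets of equal size is onto, hence the sum over
      \<open>A\<^sub>3 - {x}\<close> may be reindexed.\<close>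
    have "h ` (A\<^sub>1 - {x}) = A\<^sub>3 - {x}"
      using h inj fin A by (intro card_subset_eq) (auto simp: card_image)
    then have "(\<Sum>s\<in>A\<^sub>3 - {x}. X s) = (\<Sum>p\<in>A\<^sub>1 - {x}. X (h p))"
      using inj by (metis (no_types, lifting) sum.reindex_cong)
    also have "\<dots> = (\<Sum>p\<in>A\<^sub>1 - {x}. X p + \<rho> * Y r)"
      by (rule sum.cong[OF refl]) (use h eq[OF _ r2] in blast)
    finally show ?thesis by (simp add: sum.distrib)
  qed
  have "of_nat (card (A\<^sub>1 - {x})) * (\<rho> * Y q) = of_nat (card (A\<^sub>1 - {x})) * (\<rho> * Y q')"
    using trans[OF sums[of q, symmetric] sums[of q']] by (simp only: add_left_cancel) simp
  then have "Y q = Y q'" using pos rho by simp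
  moreover obtain c d where "w q = (Y q * c, 0, c)" "w q' = (Y q' * d, 0, d)"
    using vec2[OF q(1)] vec2[OF q(2)] by blast
  ultimately have "det3 (w q) (w q') t = 0" for t
    by (cases t) (simp add: algebra_simps)
  moreover have "\<exists>t. det3 (w q) (w q') t \<noteq> 0"
    by (rule w.independent) (use q subL in auto)
  ultimately show False by simp
qed

end

section \<open>The complex weight bounds for ten and seven elements\<close>

locale represented_ten_lines = represented_space + ten_lines
begin

lemma contradiction: False
proof (cases "\<exists>x\<in>L. 3 \<le> deg 4 x")
  case True
  then obtain x where "x \<in> L" "3 \<le> deg 4 x" by blast
  then obtain A1 A2 A3 q q' where *:
    "A1 \<in> \<B>" "A2 \<in> \<B>" "A3 \<in> \<B>" "A1 \<noteq> A2" "A1 \<noteq> A3" "A2 \<noteq> A3"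
    "x \<in> A1" "x \<in> A2" "x \<in> A3" "card A1 = 4" "card A2 = 4" "card A3 = 4"
    "q \<in> A2 - {x}" "q' \<in> A2 - {x}" "q \<noteq> q'"
    "\<And>p r. r \<in> {q, q'} \<Longrightarrow> p \<in> A1 - {x} \<Longrightarrow> \<exists>B\<in>\<B>. \<exists>s\<in>A3 - {x}. {p, r, s} \<subseteq> B"
    by (rule concurrent_four_points) blast
  have "card A1 = card A3" using * by simp
  then show False by (rule no_three_parallel_classes[OF *(1-9) _ *(13-16)])
next
  case False
  then have deg4: "\<forall>x\<in>L. deg 4 x \<le> 2" by force
  then have n: "num 4 = 4" using four_blocks_case(2) not_three_four_blocks by blast
  then obtain A1 A2 A3 A4 where F: "{B\<in>\<B>. card B = 4} = {A1, A2, A3, A4}"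
    "A1 \<noteq> A2" "A1 \<noteq> A3" "A1 \<noteq> A4" "A2 \<noteq> A3" "A2 \<noteq> A4" "A3 \<noteq> A4"
  proof -
    have "card {B\<in>\<B>. card B = 4} = Suc 3" using n by (simp add: num_def)
    then obtain A1 S where S: "{B\<in>\<B>. card B = 4} = insert A1 S" "A1 \<notin> S" "card S = 3"
      unfolding card_Suc_eq by blast
    then obtain A2 A3 A4 where "S = {A2, A3, A4}" "A2 \<noteq> A3" "A2 \<noteq> A4" "A3 \<noteq> A4"
      unfolding card_3_iff by blast
    then show thesis using that[of A1 A2 A3 A4] S by blast
  qed
  have "A1 \<in> {B\<in>\<B>. card B = 4}" "A2 \<in> {B\<in>\<B>. card B = 4}" "A3 \<in> {B\<in>\<B>. card B = 4}" "A4 \<in> {B\<in>\<B>. card B = 4}"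
    unfolding F by auto
  then have A: "A1 \<in> \<B>" "A2 \<in> \<B>" "A3 \<in> \<B>" "A4 \<in> \<B>" "card A1 = 4" "card A2 = 4" "card A3 = 4" "card A4 = 4"
    by auto
  have F13: "{B\<in>\<B>. card B = 4} = {A1, A3, A2, A4}" and F14: "{B\<in>\<B>. card B = 4} = {A1, A4, A2, A3}"
    and F23: "{B\<in>\<B>. card B = 4} = {A2, A3, A1, A4}" and F24: "{B\<in>\<B>. card B = 4} = {A2, A4, A1, A3}"
    and F34: "{B\<in>\<B>. card B = 4} = {A3, A4, A1, A2}"
    unfolding F(1) by (simp_all add: insert_commute)
  note ne = F(2-) F(2-)[symmetric]
  have "A1 \<inter> A2 \<noteq> {}" by (rule four_blocks_meet[OF F(1)]; rule ne)
  then obtain v12 where v12: "v12 \<in> A1" "v12 \<in> A2" by blast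
  have "A1 \<inter> A3 \<noteq> {}" by (rule four_blocks_meet[OF F13]; rule ne)
  then obtain v13 where v13: "v13 \<in> A1" "v13 \<in> A3" by blast
  have "A1 \<inter> A4 \<noteq> {}" by (rule four_blocks_meet[OF F14]; rule ne)
  then obtain v14 where v14: "v14 \<in> A1" "v14 \<in> A4" by blast
  have "A2 \<inter> A3 \<noteq> {}" by (rule four_blocks_meet[OF F23]; rule ne)
  then obtain v23 where v23: "v23 \<in> A2" "v23 \<in> A3" by blast
  have "A2 \<inter> A4 \<noteq> {}" by (rule four_blocks_meet[OF F24]; rule ne)
  then obtain v24 where v24: "v24 \<in> A2" "v24 \<in> A4" by blast
  have "A3 \<inter> A4 \<noteq> {}" by (rule four_blocks_meet[OF F34]; rule ne)
  then obtain v34 where v34: "v34 \<in> A3" "v34 \<in> A4" by blast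
  note v = v12 v13 v14 v23 v24 v34
  have two: "y \<notin> Z" if "X \<in> \<B>" "Y \<in> \<B>" "Z \<in> \<B>" "card X = 4" "card Y = 4" "card Z = 4"
    "X \<noteq> Y" "X \<noteq> Z" "Y \<noteq> Z" "y \<in> X" "y \<in> Y" for X Y Z y
  proof
    assume "y \<in> Z"
    then have "card {X, Y, Z} \<le> deg 4 y" using that by (intro deg_ge_card) auto
    moreover have "card {X, Y, Z} = 3" using that by simp
    moreover have "deg 4 y \<le> 2" using deg4 that block_subset by blast
    ultimately show False by simp
  qed
  have nin: "v12 \<notin> A3" "v12 \<notin> A4" "v13 \<notin> A2" "v13 \<notin> A4" "v14 \<notin> A2" "v14 \<notin> A3"
    "v23 \<notin> A1" "v23 \<notin> A4" "v24 \<notin> A1" "v24 \<notin> A3" "v34 \<notin> A1" "v34 \<notin> A2"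
    by (rule two; (rule A v ne)+)+
  \<comment> \<open>The three other blocks of size four take at most one element each, so a fourth
    element is left over.\<close>
  have extra: "\<exists>e\<in>X. e \<notin> P \<and> e \<notin> Q \<and> e \<notin> R" if X: "X \<in> \<B>" "P \<in> \<B>" "Q \<in> \<B>" "R \<in> \<B>" "card X = 4"
    "P \<noteq> X" "Q \<noteq> X" "R \<noteq> X" for X P Q R
  proof (rule ccontr)
    assume "\<not> ?thesis"
    then have "X = (X \<inter> P) \<union> (X \<inter> Q) \<union> (X \<inter> R)" by blast
    then have "card X \<le> card (X \<inter> P \<union> X \<inter> Q) + card (X \<inter> R)" by (metis card_Un_le)
    also have "\<dots> \<le> card (X \<inter> P) + card (X \<inter> Q) + card (X \<inter> R)" by (simp add: card_Un_le)
    also have "\<dots> \<le> 1 + 1 + 1"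
      by (intro add_mono card_blocks_meet_le X)
    finally show False using X by simp
  qed
  obtain e1 where e1: "e1 \<in> A1" "e1 \<notin> A2" "e1 \<notin> A3" "e1 \<notin> A4" using extra[OF A(1-5)] ne by metis
  obtain e2 where e2: "e2 \<in> A2" "e2 \<notin> A1" "e2 \<notin> A3" "e2 \<notin> A4" using extra[OF A(2,1,3,4,6)] ne by metis
  obtain e3 where e3: "e3 \<in> A3" "e3 \<notin> A1" "e3 \<notin> A2" "e3 \<notin> A4" using extra[OF A(3,1,2,4,7)] ne by metis
  obtain e4 where e4: "e4 \<in> A4" "e4 \<notin> A1" "e4 \<notin> A2" "e4 \<notin> A3" using extra[OF A(4,1,2,3,8)] ne by metis
  note third = four_blocks_third[OF deg4 n]
  have free: "\<not> {v12, v13, v23} \<subseteq> B" if "B \<in> \<B>" for B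
    using block_unique[OF that A(1), of v12 v13] v nin by auto
  show False
  proof (rule no_quadrangle[OF A(1-4) _ _ _ _ _ _ _ _ _ _ _ _ _ _ free])
    show "\<exists>T\<in>\<B>. {v12, e3, e4} \<subseteq> T"
      by (rule third[OF F(1), where g = v34]) (use ne v nin e3 e4 in auto)
    show "\<exists>T\<in>\<B>. {v13, e2, e4} \<subseteq> T"
      by (rule third[OF F13, where g = v24]) (use ne v nin e2 e4 in auto)
    show "\<exists>T\<in>\<B>. {v14, e2, e3} \<subseteq> T"
      by (rule third[OF F14, where g = v23]) (use ne v nin e2 e3 in auto)
    show "\<exists>T\<in>\<B>. {v23, e1, e4} \<subseteq> T"
      by (rule third[OF F23, where g = v14]) (use ne v nin e1 e4 in auto)
    show "\<exists>T\<in>\<B>. {v24, e1, e3} \<subseteq> T"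
      by (rule third[OF F24, where g = v13]) (use ne v nin e1 e3 in auto)
    show "\<exists>T\<in>\<B>. {v34, e1, e2} \<subseteq> T"
      by (rule third[OF F34, where g = v12]) (use ne v nin e1 e2 in auto)
  qed (use v nin e1 e2 e3 e4 in auto)
qed

end

context represented_space begin

text \<open>If all blocks have two or three elements, the total weight is
  \<open>21 + 7 * num 3\<close>. It exceeds 63 only for seven triple blocks, and then no double
  block is left, which is the Fano plane.\<close>

lemma represented_weight_bound_7:
  assumes "card L = 7" shows "(\<Sum>B\<in>\<B>. 9 * int (card B) - 17) \<le> 9 * int (card L)"
proof (cases "\<exists>A\<in>\<B>. 4 \<le> card A")
  case True
  then obtain A where A: "A \<in> \<B>" "4 \<le> card A" by blast
  have "(\<Sum>B\<in>\<B>. 9 * int (card B) - 17) \<le> (9 * int (card A) - 17)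
    + 1 * (int (card A) * (int (card L) - int (card A)))
    + 4 * ((int (card L) - int (card A)) * (int (card L) - int (card A) - 1))"
    using assms by (intro size_bound[OF A(1), of 7]) (auto simp: upt_rec)
  moreover have "card A \<in> {4, 5, 6, 7}"
    using A block_card_range[OF A(1), of 7] assms by (auto simp: upt_rec)
  ultimately show ?thesis using assms by (auto simp: sum_subtractf simp flip: sum_distrib_left)
next
  case False
  then have le: "\<forall>B\<in>\<B>. card B \<le> 3" by force
  have "{2..3} = {2, 3::nat}" by auto
  then have n: "num 2 + 3 * num 3 = 21" "(\<Sum>B\<in>\<B>. 9 * int (card B) - 17) = int (num 2) + 10 * int (num 3)"
    using sum_blocks_by_size[OF le, of "\<lambda>r. r * (r - 1)"] sum_block_pairs assms
      sum_blocks_by_size[OF le, of "\<lambda>r. 9 * int r - 17"]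
    by auto
  obtain B where "B \<in> \<B>" "card B \<noteq> 3" using not_fano[OF assms] by blast
  then have "B \<in> {B\<in>\<B>. card B = 2}" using le block_card_ge by force
  then have "num 2 \<noteq> 0" unfolding num_def using finite_blocks by auto
  then have "num 3 \<le> 6" using n by simp
  then show ?thesis using n assms by linarith
qed

text \<open>Blocks of at least five elements leave room in the charging argument. For size five the
  rate -8 is the doubled weight -4 of a double block, so crossing pairs lower the total; it is
  \<open>82 - 200 + 380\<close>, below 300.\<close>

lemma represented_weight_bound_10:
  assumes "card L = 10" shows "(\<Sum>B\<in>\<B>. 15 * int (card B) - 34) \<le> 15 * int (card L)"
proof -
  consider A where "A \<in> \<B>" "6 \<le> card A" | A where "A \<in> \<B>" "card A = 5"
    | "\<forall>A\<in>\<B>. card A \<le> 4" by force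
  then show ?thesis
  proof cases
    case A: 1
    have "(\<Sum>B\<in>\<B>. 2 * (15 * int (card B) - 34)) \<le> 2 * (15 * int (card A) - 34)
      + 0 * (int (card A) * (int (card L) - int (card A)))
      + 11 * ((int (card L) - int (card A)) * (int (card L) - int (card A) - 1))"
      using assms by (intro size_bound[OF A(1), of 10]) (auto simp: upt_rec)
    moreover have "card A \<in> {6, 7, 8, 9, 10}"
      using A block_card_range[OF A(1), of 10] assms by (auto simp: upt_rec)
    ultimately show ?thesis using assms by (auto simp: sum_subtractf simp flip: sum_distrib_left)
  next
    case A: 2
    have "(\<Sum>B\<in>\<B>. 2 * (15 * int (card B) - 34)) \<le> 2 * (15 * int (card A) - 34)
      + (- 8) * (int (card A) * (int (card L) - int (card A)))
      + 19 * ((int (card L) - int (card A)) * (int (card L) - int (card A) - 1))"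
      using assms by (intro size_bound[OF A(1), of 10]) (auto simp: upt_rec)
    then show ?thesis using assms A by (auto simp: sum_subtractf simp flip: sum_distrib_left)
  next
    case 3
    show ?thesis
    proof (rule ccontr)
      assume "\<not> ?thesis"
      then interpret represented_ten_lines L \<B> v
        using 3 assms by unfold_locales auto
      show False by (rule contradiction)
    qed
  qed
qed

end

section \<open>Projective planes over fields\<close>

definition cross3 :: "('a, 'b) ring_scheme \<Rightarrow> 'a \<times> 'a \<times> 'a \<Rightarrow> 'a \<times> 'a \<times> 'a \<Rightarrow> 'a \<times> 'a \<times> 'a" where
  "cross3 R u v = (case u of (a, b, c) \<Rightarrow> case v of (d, e, f) \<Rightarrow>
    (b \<otimes>\<^bsub>R\<^esub> f \<ominus>\<^bsub>R\<^esub> c \<otimes>\<^bsub>R\<^esub> e, c \<otimes>\<^bsub>R\<^esub> d \<ominus>\<^bsub>R\<^esub> a \<otimes>\<^bsub>R\<^esub> f, a \<otimes>\<^bsub>R\<^esub> e \<ominus>\<^bsub>R\<^esub> b \<otimes>\<^bsub>R\<^esub> d))"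

definition blocks :: "('a, 'b) ring_scheme \<Rightarrow> ('a \<times> 'a \<times> 'a) set set \<Rightarrow> ('a \<times> 'a \<times> 'a) set set set" where
  "blocks R L = (\<lambda>P. {l\<in>L. incident R l P}) ` sing_points R L"

context field
begin

lemma bil3_smul3:
  assumes "u \<in> carrier R \<times> carrier R \<times> carrier R" "v \<in> carrier R \<times> carrier R \<times> carrier R"
    "c \<in> carrier R" "d \<in> carrier R"
  shows "bil3 R (smul3 R c u) (smul3 R d v) = (c \<otimes> d) \<otimes> bil3 R u v"
  using assms by (cases u; cases v) (simp add: bil3_def smul3_def, algebra)

lemma bil3_closed:
  assumes "u \<in> carrier R \<times> carrier R \<times> carrier R" "v \<in> carrier R \<times> carrier R \<times> carrier R"
  shows "bil3 R u v \<in> carrier R"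
  using assms by (cases u; cases v) (simp add: bil3_def)

lemma smul3_smul3:
  assumes "u \<in> carrier R \<times> carrier R \<times> carrier R" "c \<in> carrier R" "d \<in> carrier R"
  shows "smul3 R d (smul3 R c u) = smul3 R (d \<otimes> c) u"
  using assms by (cases u) (simp add: smul3_def m_assoc)

lemma smul3_one:
  assumes "u \<in> carrier R \<times> carrier R \<times> carrier R" shows "smul3 R \<one> u = u"
  using assms by (cases u) (simp add: smul3_def)

lemma pclass_self:
  assumes "u \<in> carrier R \<times> carrier R \<times> carrier R" shows "u \<in> pclass R u"
  unfolding pclass_def using smul3_one[OF assms] by (force intro: exI[of _ \<one>])

lemma inv_nonzero:
  assumes "c \<in> carrier R" "c \<noteq> \<zero>"
  shows "inv c \<in> carrier R" "inv c \<noteq> \<zero>" "inv c \<otimes> c = \<one>" "c \<otimes> inv c = \<one>"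
proof -
  have c: "c \<in> Units R" using assms field_Units by auto
  then show "inv c \<in> carrier R" "inv c \<otimes> c = \<one>" "c \<otimes> inv c = \<one>" by auto
  then show "inv c \<noteq> \<zero>" using assms by auto
qed

lemma pclass_smul3:
  assumes u: "u \<in> carrier R \<times> carrier R \<times> carrier R" and c: "c \<in> carrier R" "c \<noteq> \<zero>"
  shows "pclass R (smul3 R c u) = pclass R u"
proof (intro equalityI subsetI)
  fix w assume "w \<in> pclass R (smul3 R c u)"
  then obtain d where "d \<in> carrier R" "d \<noteq> \<zero>" "w = smul3 R d (smul3 R c u)" by (auto simp: pclass_def)
  then have "d \<otimes> c \<in> carrier R" "d \<otimes> c \<noteq> \<zero>" "w = smul3 R (d \<otimes> c) u"
    using c u integral smul3_smul3 by auto
  then show "w \<in> pclass R u" by (auto simp: pclass_def)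
next
  fix w assume "w \<in> pclass R u"
  then obtain d where d: "d \<in> carrier R" "d \<noteq> \<zero>" "w = smul3 R d u" by (auto simp: pclass_def)
  note ic = inv_nonzero[OF c]
  have "smul3 R (d \<otimes> inv c) (smul3 R c u) = w"
    using d u c ic by (simp add: smul3_smul3 m_assoc)
  moreover have "d \<otimes> inv c \<in> carrier R" "d \<otimes> inv c \<noteq> \<zero>" using d ic integral by auto
  ultimately show "w \<in> pclass R (smul3 R c u)" by (force simp: pclass_def)
qed

text \<open>Rescaling both vectors multiplies \<open>bil3\<close> by a nonzero scalar, so the choice
  of representatives in \<open>incident\<close> is immaterial.\<close>

lemma incident_pclass:
  assumes "nzvec R u" "nzvec R v"
  shows "incident R (pclass R u) (pclass R v) \<longleftrightarrow> bil3 R u v = \<zero>"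
proof
  have uv: "u \<in> carrier R \<times> carrier R \<times> carrier R" "v \<in> carrier R \<times> carrier R \<times> carrier R"
    using assms by (auto simp: nzvec_def)
  assume "incident R (pclass R u) (pclass R v)"
  then obtain c d where "c \<in> carrier R" "c \<noteq> \<zero>" "d \<in> carrier R" "d \<noteq> \<zero>"
    "bil3 R (smul3 R c u) (smul3 R d v) = \<zero>"
    by (auto simp: incident_def pclass_def)
  then show "bil3 R u v = \<zero>"
    using uv integral bil3_closed[OF uv] by (auto simp: bil3_smul3)
next
  assume "bil3 R u v = \<zero>"
  then show "incident R (pclass R u) (pclass R v)"
    unfolding incident_def using assms pclass_self by (auto simp: nzvec_def)
qed

lemma cross3_closed:
  assumes "u \<in> carrier R \<times> carrier R \<times> carrier R" "v \<in> carrier R \<times> carrier R \<times> carrier R"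
  shows "cross3 R u v \<in> carrier R \<times> carrier R \<times> carrier R"
  using assms by (cases u; cases v) (simp add: cross3_def)

lemma bil3_cross3:
  assumes "u \<in> carrier R \<times> carrier R \<times> carrier R" "v \<in> carrier R \<times> carrier R \<times> carrier R"
  shows "bil3 R u (cross3 R u v) = \<zero>" "bil3 R v (cross3 R u v) = \<zero>"
  using assms by (cases u; cases v; simp add: bil3_def cross3_def, algebra)+

lemma minus_eq_zeroD:
  assumes "x \<in> carrier R" "y \<in> carrier R" "x \<ominus> y = \<zero>" shows "x = y"
proof -
  have "x = (x \<ominus> y) \<oplus> y" using assms(1,2) by algebra
  then show ?thesis using assms by simp
qed

lemma cross3_zero:
  assumes u: "nzvec R u" and v: "nzvec R v" and 0: "cross3 R u v = (\<zero>, \<zero>, \<zero>)"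
  shows "pclass R u = pclass R v"
proof -
  obtain a b c d e f where [simp]: "u = (a, b, c)" "v = (d, e, f)" by (metis prod_cases3)
  have car [simp]: "a \<in> carrier R" "b \<in> carrier R" "c \<in> carrier R" "d \<in> carrier R" "e \<in> carrier R" "f \<in> carrier R"
    using u v by (auto simp: nzvec_def)
  have eqs: "b \<otimes> f = c \<otimes> e" "c \<otimes> d = a \<otimes> f" "a \<otimes> e = b \<otimes> d"
    using 0 by (auto simp: cross3_def intro: minus_eq_zeroD)
  have ratio: "(z \<otimes> inv x) \<otimes> w = y" if "x \<in> carrier R" "x \<noteq> \<zero>" "y \<in> carrier R" "z \<in> carrier R" "w \<in> carrier R"
    "x \<otimes> y = w \<otimes> z" for x y z w
  proof -
    note ix = inv_nonzero[OF that(1,2)]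
    have "(z \<otimes> inv x) \<otimes> w = inv x \<otimes> (w \<otimes> z)" using that ix by algebra
    also have "\<dots> = (inv x \<otimes> x) \<otimes> y" unfolding that(6)[symmetric]
      by (rule m_assoc[symmetric]) (use that ix in auto)
    finally show ?thesis using that(3) ix(3) by simp
  qed
  have "\<exists>k\<in>carrier R. v = smul3 R k u"
  proof -
    \<comment> \<open>Any nonzero coordinate of \<open>u\<close> may serve as denominator; the
      cross-multiplied equations then give the other two coordinates.\<close>
    consider "a \<noteq> \<zero>" | "b \<noteq> \<zero>" | "c \<noteq> \<zero>" using u by (auto simp: nzvec_def)
    then show ?thesis
    proof cases
      case 1
      have "smul3 R (d \<otimes> inv a) u = v"
        using ratio[OF car(1) 1 car(4,4,1) refl] ratio[OF car(1) 1 car(5,4,2) eqs(3)]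
          ratio[OF car(1) 1 car(6,4,3) eqs(2)[symmetric]] by (simp add: smul3_def)
      then show ?thesis using 1 inv_nonzero car by blast
    next
      case 2
      have "smul3 R (e \<otimes> inv b) u = v"
        using ratio[OF car(2) 2 car(4,5,1) eqs(3)[symmetric]] ratio[OF car(2) 2 car(5,5,2) refl]
          ratio[OF car(2) 2 car(6,5,3) eqs(1)] by (simp add: smul3_def)
      then show ?thesis using 2 inv_nonzero car by blast
    next
      case 3
      have "smul3 R (f \<otimes> inv c) u = v"
        using ratio[OF car(3) 3 car(4,6,1) eqs(2)] ratio[OF car(3) 3 car(5,6,2) eqs(1)[symmetric]]
          ratio[OF car(3) 3 car(6,6,3) refl] by (simp add: smul3_def)
      then show ?thesis using 3 inv_nonzero car by blast
    qed
  qed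
  then obtain k where k: "k \<in> carrier R" "v = smul3 R k u" by blast
  moreover have "k \<noteq> \<zero>" using k v by (auto simp: smul3_def nzvec_def)
  ultimately show ?thesis using u pclass_smul3[of u k] by (simp add: nzvec_def)
qed

lemma nzvec_cross3:
  assumes "nzvec R u" "nzvec R v" "pclass R u \<noteq> pclass R v" shows "nzvec R (cross3 R u v)"
  using cross3_closed[of u v] cross3_zero[OF assms(1,2)] assms unfolding nzvec_def by blast

text \<open>By the expansion of a double cross product, \<open>cross3 R (cross3 R u u') v\<close> is
  a combination of \<open>u'\<close> and \<open>u\<close> with coefficients
  \<open>bil3 R u v\<close> and \<open>bil3 R u' v\<close>, both zero.\<close>

lemma pclass_meet:
  assumes u: "nzvec R u" "nzvec R u'" "pclass R u \<noteq> pclass R u'"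
    and v: "nzvec R v" "bil3 R u v = \<zero>" "bil3 R u' v = \<zero>"
  shows "pclass R v = pclass R (cross3 R u u')"
proof -
  obtain a b c d e f x y z where [simp]: "u = (a, b, c)" "u' = (d, e, f)" "v = (x, y, z)" by (metis prod_cases3)
  have car [simp]: "a \<in> carrier R" "b \<in> carrier R" "c \<in> carrier R" "d \<in> carrier R" "e \<in> carrier R" "f \<in> carrier R"
    "x \<in> carrier R" "y \<in> carrier R" "z \<in> carrier R"
    using u v by (auto simp: nzvec_def)
  have 0: "a \<otimes> x \<oplus> b \<otimes> y \<oplus> c \<otimes> z = \<zero>" "d \<otimes> x \<oplus> e \<otimes> y \<oplus> f \<otimes> z = \<zero>"
    using v by (simp_all add: bil3_def)
  have "(c \<otimes> d \<ominus> a \<otimes> f) \<otimes> z \<ominus> (a \<otimes> e \<ominus> b \<otimes> d) \<otimes> y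
    = d \<otimes> (a \<otimes> x \<oplus> b \<otimes> y \<oplus> c \<otimes> z) \<ominus> a \<otimes> (d \<otimes> x \<oplus> e \<otimes> y \<oplus> f \<otimes> z)"
    using car by algebra
  moreover have "(a \<otimes> e \<ominus> b \<otimes> d) \<otimes> x \<ominus> (b \<otimes> f \<ominus> c \<otimes> e) \<otimes> z
    = e \<otimes> (a \<otimes> x \<oplus> b \<otimes> y \<oplus> c \<otimes> z) \<ominus> b \<otimes> (d \<otimes> x \<oplus> e \<otimes> y \<oplus> f \<otimes> z)"
    using car by algebra
  moreover have "(b \<otimes> f \<ominus> c \<otimes> e) \<otimes> y \<ominus> (c \<otimes> d \<ominus> a \<otimes> f) \<otimes> x
    = f \<otimes> (a \<otimes> x \<oplus> b \<otimes> y \<oplus> c \<otimes> z) \<ominus> c \<otimes> (d \<otimes> x \<oplus> e \<otimes> y \<oplus> f \<otimes> z)"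
    using car by algebra
  ultimately have "cross3 R (cross3 R u u') v = (\<zero>, \<zero>, \<zero>)"
    unfolding 0 by (simp add: cross3_def a_minus_def)
  then show ?thesis
    using cross3_zero[of "cross3 R u u'" v] nzvec_cross3[OF u] v by simp
qed

lemma proj_planeI: "nzvec R v \<Longrightarrow> pclass R v \<in> proj_plane R"
  unfolding proj_plane_def by blast

lemma proj_planeE:
  assumes "P \<in> proj_plane R" obtains v where "nzvec R v" "P = pclass R v"
  using assms by (auto simp: proj_plane_def)

lemma meet_point:
  assumes "l \<in> proj_plane R" "m \<in> proj_plane R" "l \<noteq> m"
  shows "\<exists>P\<in>proj_plane R. incident R l P \<and> incident R m P"
    and "\<And>P Q. P \<in> proj_plane R \<Longrightarrow> incident R l P \<Longrightarrow> incident R m P \<Longrightarrow>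
      Q \<in> proj_plane R \<Longrightarrow> incident R l Q \<Longrightarrow> incident R m Q \<Longrightarrow> P = Q"
proof -
  obtain u u' where u: "nzvec R u" "l = pclass R u" "nzvec R u'" "m = pclass R u'"
    using assms proj_planeE by metis
  have ne: "pclass R u \<noteq> pclass R u'" using u assms by simp
  have "nzvec R (cross3 R u u')" using nzvec_cross3 u ne by blast
  moreover have "bil3 R u (cross3 R u u') = \<zero>" "bil3 R u' (cross3 R u u') = \<zero>"
    using bil3_cross3 u by (auto simp: nzvec_def)
  ultimately show "\<exists>P\<in>proj_plane R. incident R l P \<and> incident R m P"
    using u incident_pclass by (intro bexI[of _ "pclass R (cross3 R u u')"]) (simp_all add: proj_planeI)
  fix P Q assume PQ: "P \<in> proj_plane R" "incident R l P" "incident R m P"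
      "Q \<in> proj_plane R" "incident R l Q" "incident R m Q"
  have "X = pclass R (cross3 R u u')" if X: "X \<in> proj_plane R" "incident R l X" "incident R m X" for X
  proof -
    obtain v where v: "nzvec R v" "X = pclass R v" using X proj_planeE by metis
    show ?thesis using pclass_meet[OF u(1,3) ne v(1)] X v u incident_pclass by simp
  qed
  then show "P = Q" using PQ by metis
qed

section \<open>The linear space of a line configuration, and configurations given by incidence
  tables\<close>

context
  fixes L assumes L: "L \<subseteq> proj_plane R" "finite L"
begin

lemma sing_pointE:
  assumes "P \<in> sing_points R L"
  obtains l m where "l \<in> L" "m \<in> L" "l \<noteq> m" "incident R l P" "incident R m P" "P \<in> proj_plane R"
proof -
  have "\<not> card {l\<in>L. incident R l P} \<le> Suc 0" "P \<in> proj_plane R"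
    using assms by (auto simp: sing_points_def mult_pt_def)
  then show thesis
    using that L(2) by (subst (asm) card_le_Suc0_iff_eq) auto
qed

lemma sing_pointI:
  assumes "P \<in> proj_plane R" "l \<in> L" "m \<in> L" "l \<noteq> m" "incident R l P" "incident R m P"
  shows "P \<in> sing_points R L"
proof -
  have "card {l, m} \<le> card {l\<in>L. incident R l P}" using assms L by (intro card_mono) auto
  then show ?thesis using assms by (simp add: sing_points_def mult_pt_def)
qed

lemma blocks_inj: "inj_on (\<lambda>P. {l\<in>L. incident R l P}) (sing_points R L)"
proof (rule inj_onI)
  fix P Q assume PQ: "P \<in> sing_points R L" "Q \<in> sing_points R L" "{l\<in>L. incident R l P} = {l\<in>L. incident R l Q}"
  obtain l m where lm: "l \<in> L" "m \<in> L" "l \<noteq> m" "incident R l P" "incident R m P" "P \<in> proj_plane R"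
    using PQ(1) by (rule sing_pointE)
  then have "l \<in> {l\<in>L. incident R l Q}" "m \<in> {l\<in>L. incident R l Q}" using PQ(3) by blast+
  moreover have "Q \<in> proj_plane R" using PQ by (auto simp: sing_points_def)
  ultimately show "P = Q" using meet_point(2)[of l m P Q] lm L by auto
qed

lemma linear_space_blocks: "linear_space L (blocks R L)"
proof
  show "finite L" by (rule L)
  show "B \<subseteq> L" "2 \<le> card B" if "B \<in> blocks R L" for B
    using that by (auto simp: blocks_def sing_points_def mult_pt_def)
  show "\<exists>B\<in>blocks R L. x \<in> B \<and> y \<in> B" if xy: "x \<in> L" "y \<in> L" "x \<noteq> y" for x y
  proof -
    obtain P where "P \<in> proj_plane R" "incident R x P" "incident R y P"
      using meet_point(1)[of x y] xy L by auto
    then show ?thesis using sing_pointI[of P x y] xy by (auto simp: blocks_def)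
  qed
  show "B = B'" if B: "B \<in> blocks R L" "B' \<in> blocks R L" "x \<noteq> y" "x \<in> B" "y \<in> B" "x \<in> B'" "y \<in> B'" for B B' x y
  proof -
    obtain P Q where PQ: "P \<in> sing_points R L" "B = {l\<in>L. incident R l P}" "Q \<in> sing_points R L" "B' = {l\<in>L. incident R l Q}"
      using B by (auto simp: blocks_def)
    have "P \<in> proj_plane R" "Q \<in> proj_plane R" using PQ by (auto simp: sing_points_def)
    then have "P = Q" using meet_point(2)[of x y P Q] B PQ L by auto
    then show ?thesis using PQ by simp
  qed
qed

lemma finite_sing_points: "finite (sing_points R L)"
proof -
  interpret linear_space L "blocks R L" by (rule linear_space_blocks)
  show ?thesis using finite_blocks finite_imageD[OF _ blocks_inj] by (simp add: blocks_def)
qed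

lemma sum_sing_points: "(\<Sum>P\<in>sing_points R L. g (mult_pt R L P)) = (\<Sum>B\<in>blocks R L. g (card B))"
  unfolding blocks_def by (subst sum.reindex[OF blocks_inj]) (simp add: mult_pt_def)

lemma card_sing_points: "card (sing_points R L) = card (blocks R L)"
  unfolding blocks_def by (simp add: card_image[OF blocks_inj])

lemma harbourne_ge:
  fixes p q :: nat
  assumes p: "0 < p" and W: "(\<Sum>B\<in>blocks R L. int p * int (card B) - int q) \<le> int p * int (card L)"
  shows "- real q / real p \<le> harbourne_const R L"
proof -
  interpret linear_space L "blocks R L" by (rule linear_space_blocks)
  let ?s = "real (card (blocks R L))" and ?m = "\<Sum>B\<in>blocks R L. real (card B)"
  have "real (card B * (card B - 1)) = real (card B) ^ 2 - real (card B)" for B :: "('a \<times> 'a \<times> 'a) set set"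
    by (cases "card B") (auto simp: power2_eq_square algebra_simps)
  then have "(\<Sum>B\<in>blocks R L. real (card B) ^ 2) - ?m = real (\<Sum>B\<in>blocks R L. card B * (card B - 1))"
    by (simp add: sum_subtractf)
  also have "\<dots> = real (card L) ^ 2 - real (card L)"
    unfolding sum_block_pairs by (cases "card L") (auto simp: power2_eq_square algebra_simps)
  finally have H: "harbourne_const R L = (real (card L) - ?m) / ?s"
    unfolding harbourne_const_def sum_sing_points[of "\<lambda>m. real m ^ 2"] card_sing_points by (simp add: algebra_simps)
  have "real_of_int (\<Sum>B\<in>blocks R L. int p * int (card B) - int q) \<le> real_of_int (int p * int (card L))"
    using W by (simp only: of_int_le_iff)
  then have W': "real p * ?m - real q * ?s \<le> real p * real (card L)"
    by (simp add: sum_subtractf mult.commute flip: sum_distrib_left)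
  show ?thesis
  proof (cases "?s = 0")
    \<comment> \<open>Without singular points the quotient has denominator zero and therefore the
      value 0, which is still at least \<open>- q / p\<close>.\<close>
    case True
    then show ?thesis by (simp add: H)
  next
    case False
    then show ?thesis using W' p by (simp add: H field_simps)
  qed
qed

end

text \<open>Three computations replace the geometric checks: different columns of the incidence
  table force different lines, different rows force different points, and the pair count certifies
  that no singular point is missing from \<open>vs\<close>.\<close>

lemma realize:
  fixes us vs :: "('a \<times> 'a \<times> 'a) list" and d :: nat
  defines "rows \<equiv> map (\<lambda>v. filter (\<lambda>i. bil3 R (us ! i) v = \<zero>) [0..<d]) vs"
  defines "D \<equiv> filter (\<lambda>r. 2 \<le> length r) rows"
  assumes nz: "\<forall>i<d. nzvec R (us ! i)" "\<forall>v\<in>set vs. nzvec R v"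
    and cols: "distinct (map (\<lambda>i. map (\<lambda>r. i \<in> set r) rows) [0..<d])"
    and D: "distinct D"
    and pairs: "(\<Sum>r\<leftarrow>D. length r * (length r - 1)) = d * (d - 1)"
  shows "\<exists>L. line_config R L d \<and> harbourne_const R L
    = (real d ^ 2 - (\<Sum>r\<leftarrow>D. real (length r) ^ 2)) / real (length D)"
proof -
  let ?l = "\<lambda>i. pclass R (us ! i)" and ?row = "\<lambda>v. filter (\<lambda>i. bil3 R (us ! i) v = \<zero>) [0..<d]"
  let ?L = "?l ` {..<d}"
  have sub: "?L \<subseteq> proj_plane R" using nz by (auto intro: proj_planeI)
  have inc: "incident R (?l i) (pclass R v) \<longleftrightarrow> i \<in> set (?row v)" if "i < d" "v \<in> set vs" for i v
    using incident_pclass[of "us ! i" v] nz that by simp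
  have inj: "inj_on ?l {..<d}"
  proof (rule inj_onI)
    fix i j assume ij: "i \<in> {..<d}" "j \<in> {..<d}" "?l i = ?l j"
    then have "map (\<lambda>r. i \<in> set r) rows = map (\<lambda>r. j \<in> set r) rows"
      unfolding rows_def using inc[of i] inc[of j] by simp
    moreover have "inj_on (\<lambda>i. map (\<lambda>r. i \<in> set r) rows) {..<d}"
      using cols by (simp add: distinct_map lessThan_atLeast0)
    ultimately show "i = j" using ij(1,2) by (blast dest: inj_onD)
  qed
  have card_L: "card ?L = d" using inj by (simp add: card_image)
  then have "line_config R ?L d" using sub by (simp add: line_config_def)
  have mult: "mult_pt R ?L (pclass R v) = length (?row v)" if v: "v \<in> set vs" for v
  proof -
    have "{l\<in>?L. incident R l (pclass R v)} = ?l ` set (?row v)"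
      using inc[OF _ v] by auto
    moreover have "inj_on ?l (set (?row v))" using inj by (rule inj_on_subset) auto
    ultimately have "mult_pt R ?L (pclass R v) = card (set (?row v))"
      by (simp only: mult_pt_def card_image)
    then show ?thesis by (simp only: distinct_card distinct_filter distinct_upt)
  qed
  let ?vs = "filter (\<lambda>v. 2 \<le> length (?row v)) vs"
  have D': "D = map ?row ?vs" unfolding D_def rows_def filter_map o_def ..
  have vs: "distinct ?vs" using D unfolding D' distinct_map by blast
  have injv: "inj_on (pclass R) (set ?vs)"
  proof (rule inj_onI)
    fix v w assume v: "v \<in> set ?vs" "w \<in> set ?vs" "pclass R v = pclass R w"
    then have "i \<in> set (?row v) \<longleftrightarrow> i \<in> set (?row w)" if "i < d" for i
      using inc[OF that, of v] inc[OF that, of w] by simp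
    then have "?row v = ?row w" by (intro filter_cong refl) simp
    then show "v = w"
      using D v(1,2) unfolding D' distinct_map by (elim conjE) (erule inj_onD)
  qed
  let ?S = "pclass R ` set ?vs"
  have S: "?S \<subseteq> sing_points R ?L" using nz mult by (auto simp: sing_points_def intro: proj_planeI)
  have sum_S: "(\<Sum>P\<in>?S. g (mult_pt R ?L P)) = (\<Sum>r\<leftarrow>D. g (length r))" for g :: "nat \<Rightarrow> 'c::comm_monoid_add"
  proof -
    have "(\<Sum>P\<in>?S. g (mult_pt R ?L P)) = (\<Sum>v\<in>set ?vs. g (mult_pt R ?L (pclass R v)))"
      by (subst sum.reindex[OF injv]) (simp only: o_def)
    also have "\<dots> = (\<Sum>v\<in>set ?vs. g (length (?row v)))" using mult by (intro sum.cong) auto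
    also have "\<dots> = (\<Sum>v\<leftarrow>?vs. g (length (?row v)))"
      by (rule sum_list_distinct_conv_sum_set[OF vs, symmetric])
    finally show ?thesis by (simp only: D' map_map o_def)
  qed
  have fin: "finite (sing_points R ?L)" using finite_sing_points sub by simp
  interpret linear_space ?L "blocks R ?L" using linear_space_blocks sub by simp
  have "(\<Sum>P\<in>sing_points R ?L. mult_pt R ?L P * (mult_pt R ?L P - 1)) = d * (d - 1)"
    using sum_block_pairs sum_sing_points[OF sub, of "\<lambda>m. m * (m - 1)"] card_L by simp
  also have "\<dots> = (\<Sum>P\<in>?S. mult_pt R ?L P * (mult_pt R ?L P - 1))"
    using sum_S[of "\<lambda>m. m * (m - 1)"] pairs by simp
  finally have eq: "(\<Sum>P\<in>sing_points R ?L. mult_pt R ?L P * (mult_pt R ?L P - 1))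
    = (\<Sum>P\<in>?S. mult_pt R ?L P * (mult_pt R ?L P - 1))" .
  \<comment> \<open>The listed points already account for all pairs, and a singular point of
    multiplicity \<open>m\<close> outside the list would add \<open>m * (m - 1)\<close>, which is
    positive.\<close>
  have "sing_points R ?L = ?S"
  proof (rule ccontr)
    assume "sing_points R ?L \<noteq> ?S"
    then obtain P where P: "P \<in> sing_points R ?L - ?S" using S by blast
    have "(\<Sum>P\<in>sing_points R ?L - ?S. mult_pt R ?L P * (mult_pt R ?L P - 1)) = 0"
      using eq sum.subset_diff[OF S fin, of "\<lambda>P. mult_pt R ?L P * (mult_pt R ?L P - 1)"] by simp
    then have "mult_pt R ?L P * (mult_pt R ?L P - 1) = 0" using P fin by simp
    then show False using P by (auto simp: sing_points_def)
  qed
  moreover have "card ?S = length D"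
    unfolding card_image[OF injv] distinct_card[OF vs] D' by simp
  ultimately have "harbourne_const R ?L
      = (real d ^ 2 - (\<Sum>r\<leftarrow>D. real (length r) ^ 2)) / real (length D)"
    unfolding harbourne_const_def using sum_S[of "\<lambda>m. real m ^ 2"] card_L by simp
  then show ?thesis using \<open>line_config R ?L d\<close> by blast
qed

end

text \<open>One table, computed for the full list, serves all initial segments of the lines: indices
  from \<open>d\<close> on are deleted from its rows. \<open>rows\<close> and \<open>D\<close> are
  tied by equations so that \<open>refl\<close> instantiates them and the simplifier evaluates the
  rest.\<close>

lemma (in field) realize_prefix:
  fixes us vs :: "('a \<times> 'a \<times> 'a) list"
  assumes M: "map (\<lambda>v. filter (\<lambda>i. bil3 R (us ! i) v = \<zero>) [0..<length us]) vs = M"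
    and nz: "\<forall>u\<in>set us. nzvec R u" "\<forall>v\<in>set vs. nzvec R v"
    and d: "d \<le> length us"
    and rows: "map (filter (\<lambda>i. i < d)) M = rows" "filter (\<lambda>r. 2 \<le> length r) rows = D"
    and cols: "distinct (map (\<lambda>i. map (\<lambda>r. i \<in> set r) rows) [0..<d])"
    and D: "distinct D" "(\<Sum>r\<leftarrow>D. length r * (length r - 1)) = d * (d - 1)"
  shows "\<exists>L. line_config R L d \<and> harbourne_const R L
    = (real d ^ 2 - (\<Sum>r\<leftarrow>D. real (length r) ^ 2)) / real (length D)"
proof -
  obtain n where "length us = d + n" using le_Suc_ex[OF d] by blast
  then have "filter (\<lambda>i. i < d) [0..<length us] = [0..<d]"
    using upt_add_eq_append[of 0 d n] by simp
  moreover have "filter P (filter Q xs) = filter Q (filter P xs)" for P Q and xs :: "nat list"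
    by (induction xs) auto
  ultimately have upt: "filter (\<lambda>i. i < d) (filter P [0..<length us]) = filter P [0..<d]" for P
    by metis
  have "map (\<lambda>v. filter (\<lambda>i. bil3 R (us ! i) v = \<zero>) [0..<d]) vs = rows"
    unfolding rows(1)[symmetric] M[symmetric] by (simp add: upt del: filter_filter)
  then show ?thesis
    using realize[of d us vs] nz cols D rows(2) d by simp
qed

section \<open>Prime fields on natural numbers and the complex field\<close>

definition zmod :: "nat \<Rightarrow> nat ring" where
  "zmod p = \<lparr>carrier = {..<p}, monoid.mult = (\<lambda>a b. a * b mod p), one = 1, zero = 0,
    add = (\<lambda>a b. (a + b) mod p)\<rparr>"

lemma zmod_simps [simp]:
  "carrier (zmod p) = {..<p}" "a \<otimes>\<^bsub>zmod p\<^esub> b = a * b mod p" "\<one>\<^bsub>zmod p\<^esub> = 1"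
  "\<zero>\<^bsub>zmod p\<^esub> = 0" "a \<oplus>\<^bsub>zmod p\<^esub> b = (a + b) mod p"
  by (simp_all add: zmod_def)

lemma field_zmod:
  assumes p: "prime p" shows "field (zmod p)"
proof -
  have p1: "1 < p" using p prime_gt_1_nat by blast
  have cring: "cring (zmod p)"
  proof (rule cringI)
    show "abelian_group (zmod p)"
    proof (rule abelian_groupI)
      show "\<exists>y\<in>carrier (zmod p). y \<oplus>\<^bsub>zmod p\<^esub> x = \<zero>\<^bsub>zmod p\<^esub>" if "x \<in> carrier (zmod p)" for x
        using that p1 by (intro bexI[of _ "(p - x) mod p"]) (auto simp: mod_simps)
    qed (use p1 in \<open>auto simp: mod_simps ac_simps\<close>)
    show "Group.comm_monoid (zmod p)"
      by (rule comm_monoidI) (use p1 in \<open>auto simp: mod_simps ac_simps\<close>)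
  qed (use p1 in \<open>auto simp: mod_simps algebra_simps\<close>)
  have inverse: "\<exists>y<p. x * y mod p = 1" if x: "0 < x" "x < p" for x
  proof -
    have "coprime x p" using p x by (metis coprime_commute nat_dvd_not_less prime_imp_coprime)
    then obtain y where "[x * y = Suc 0] (mod p)" using cong_solve_coprime_nat by blast
    then show ?thesis
      using p1 by (intro exI[of _ "y mod p"]) (auto simp: cong_def mod_simps)
  qed
  have unit: "x \<in> Units (zmod p)" if x: "0 < x" "x < p" for x
  proof -
    obtain y where y: "y < p" "x * y mod p = 1"
      using inverse[OF x] by blast
    then have "y * x mod p = 1" by (simp only: mult.commute)
    then show ?thesis using x y by (simp only: Units_def zmod_simps mem_Collect_eq lessThan_iff) blast
  qed
  have "Units (zmod p) = carrier (zmod p) - {\<zero>\<^bsub>zmod p\<^esub>}"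
  proof (intro equalityI subsetI)
    show "x \<in> carrier (zmod p) - {\<zero>\<^bsub>zmod p\<^esub>}" if "x \<in> Units (zmod p)" for x
      using that p1 by (cases "x = 0") (auto simp: Units_def)
    show "x \<in> Units (zmod p)" if "x \<in> carrier (zmod p) - {\<zero>\<^bsub>zmod p\<^esub>}" for x
      using unit[of x] that by simp
  qed
  then show ?thesis using cring by (intro cring.cring_fieldI)
qed

lemma bil3_zmod: "bil3 (zmod p) (a, b, c) (x, y, z) = (a * x + b * y + c * z) mod p"
  by (simp add: bil3_def mod_simps)

lemma complex_field_simps [simp]:
  "carrier complex_field = UNIV" "a \<otimes>\<^bsub>complex_field\<^esub> b = a * b" "\<one>\<^bsub>complex_field\<^esub> = 1"
  "\<zero>\<^bsub>complex_field\<^esub> = 0" "a \<oplus>\<^bsub>complex_field\<^esub> b = a + b"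
  by (simp_all add: complex_field_def)

lemma field_complex_field: "field complex_field"
proof -
  have "cring complex_field"
  proof (rule cringI)
    show "abelian_group complex_field"
    proof (rule abelian_groupI)
      show "\<exists>y\<in>carrier complex_field. y \<oplus>\<^bsub>complex_field\<^esub> x = \<zero>\<^bsub>complex_field\<^esub>" for x
        by (intro bexI[of _ "- x"]) auto
    qed auto
    show "Group.comm_monoid complex_field" by (rule comm_monoidI) auto
  qed (auto simp: algebra_simps)
  moreover have "Units complex_field = carrier complex_field - {\<zero>\<^bsub>complex_field\<^esub>}"
    by (auto simp: Units_def) (metis mult.commute right_inverse)
  ultimately show ?thesis by (intro cring.cring_fieldI)
qed

interpretation C: field complex_field by (rule field_complex_field)

lemma complex_field_minus [simp]: "a \<ominus>\<^bsub>complex_field\<^esub> b = a - b"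
proof -
  have "\<ominus>\<^bsub>complex_field\<^esub> b = - b" using C.minus_equality[of "- b" b] by simp
  then show ?thesis by (simp add: a_minus_def)
qed

lemma det3_bil3: "det3 u v w = bil3 complex_field w (cross3 complex_field u v)"
  by (cases u; cases v; cases w) (simp add: bil3_def cross3_def algebra_simps)

text \<open>The common point is a nonzero kernel vector. The determinant times each of its
  coordinates is a combination of the three incidence equations, as with the adjugate
  matrix.\<close>

lemma det3_bil3_zero:
  assumes "nzvec complex_field p" "bil3 complex_field u p = 0" "bil3 complex_field v p = 0" "bil3 complex_field w p = 0"
  shows "det3 u v w = 0"
proof -
  obtain a b c d e f g h i x y z where [simp]: "u = (a, b, c)" "v = (d, e, f)" "w = (g, h, i)" "p = (x, y, z)"
    by (metis prod_cases3)
  have eqs: "a * x + b * y + c * z = 0" "d * x + e * y + f * z = 0" "g * x + h * y + i * z = 0"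
    using assms by (simp_all add: bil3_def)
  have "det3 u v w * x = 0" "det3 u v w * y = 0" "det3 u v w * z = 0"
    using eqs by (simp_all only: \<open>u = _\<close> \<open>v = _\<close> \<open>w = _\<close> det3.simps) Groebner_Basis.algebra+
  then show ?thesis using assms(1) by (auto simp: nzvec_def)
qed

text \<open>Coefficient vectors of the lines form the representation. The cross product of two of
  them is the intersection point, and by \<open>det3_bil3\<close> a zero determinant says that the
  third line passes through it.\<close>

lemma represented_space_complex:
  assumes L: "L \<subseteq> proj_plane complex_field" "finite L"
  obtains v :: "(complex \<times> complex \<times> complex) set \<Rightarrow> complex \<times> complex \<times> complex"
  where "represented_space L (blocks complex_field L) v"
proof -
  have "\<forall>l\<in>L. \<exists>u. nzvec complex_field u \<and> l = pclass complex_field u"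
    using L C.proj_planeE by blast
  from bchoice[OF this] obtain v where
    v: "\<And>l. l \<in> L \<Longrightarrow> nzvec complex_field (v l)" "\<And>l. l \<in> L \<Longrightarrow> l = pclass complex_field (v l)"
    by blast
  interpret linear_space L "blocks complex_field L" by (rule C.linear_space_blocks[OF L])
  have inc: "incident complex_field l (pclass complex_field p) \<longleftrightarrow> bil3 complex_field (v l) p = 0"
    if "l \<in> L" "nzvec complex_field p" for l p
    using C.incident_pclass[OF v(1)[OF that(1)] that(2)] v(2)[OF that(1)] by simp
  have ne: "nzvec complex_field (cross3 complex_field (v x) (v y))" if "x \<in> L" "y \<in> L" "x \<noteq> y" for x y
    using C.nzvec_cross3[OF v(1)[OF that(1)] v(1)[OF that(2)]] v(2) that by metis
  have "represented_space L (blocks complex_field L) v"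
  proof
    show "det3 (v x) (v y) (v z) = 0" if B: "B \<in> blocks complex_field L" "x \<in> B" "y \<in> B" "z \<in> B" for B x y z
    proof -
      obtain P where P: "P \<in> proj_plane complex_field" "B = {l\<in>L. incident complex_field l P}"
        using B by (auto simp: blocks_def sing_points_def)
      obtain p where p: "nzvec complex_field p" "P = pclass complex_field p" using P C.proj_planeE by blast
      show ?thesis by (rule det3_bil3_zero[OF p(1)]) (use B P p(2) inc[OF _ p(1)] in auto)
    qed
    show "\<exists>B\<in>blocks complex_field L. {x, y, z} \<subseteq> B"
      if x: "x \<in> L" "y \<in> L" "z \<in> L" "x \<noteq> y" "det3 (v x) (v y) (v z) = 0" for x y z
    proof -
      let ?w = "cross3 complex_field (v x) (v y)"
      have "bil3 complex_field (v x) ?w = 0" "bil3 complex_field (v y) ?w = 0"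
        using C.bil3_cross3[of "v x" "v y"] by (simp_all add: mem_Times_iff)
      moreover have "bil3 complex_field (v z) ?w = 0" using x det3_bil3 by metis
      ultimately have i: "\<And>l. l \<in> {x, y, z} \<Longrightarrow> incident complex_field l (pclass complex_field ?w)"
        using inc[OF _ ne[OF x(1,2,4)]] x by auto
      have "pclass complex_field ?w \<in> sing_points complex_field L"
        by (rule C.sing_pointI[OF L C.proj_planeI[OF ne[OF x(1,2,4)]] x(1,2,4)]) (use i in auto)
      then show ?thesis unfolding blocks_def using i x by auto
    qed
    show "\<exists>w. det3 (v x) (v y) w \<noteq> 0" if x: "x \<in> L" "y \<in> L" "x \<noteq> y" for x y
    proof -
      obtain a b c where w: "cross3 complex_field (v x) (v y) = (a, b, c)" by (metis prod_cases3)
      \<comment> \<open>Pairing the nonzero cross product with its conjugate gives a sum of squared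
        moduli, a ready witness of independence.\<close>
      have "det3 (v x) (v y) (cnj a, cnj b, cnj c) = complex_of_real ((cmod a)\<^sup>2 + (cmod b)\<^sup>2 + (cmod c)\<^sup>2)"
        unfolding det3_bil3 w by (simp add: bil3_def mult.commute[of "cnj _"] flip: complex_norm_square)
      moreover have "(cmod a)\<^sup>2 + (cmod b)\<^sup>2 + (cmod c)\<^sup>2 \<noteq> 0"
        using ne[OF x] by (auto simp: w nzvec_def add_nonneg_eq_0_iff)
      ultimately show ?thesis by (metis of_real_eq_0_iff)
    qed
  qed
  then show thesis by (rule that)
qed

section \<open>Lower bounds and extremal configurations\<close>

lemma harbourne_lower:
  assumes F: "field R" and L: "line_config R L d" and dv: "(d, v) \<in> set HL_abs_table"
  shows "v \<le> harbourne_const R L"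
proof -
  interpret field R by (rule F)
  have L': "L \<subseteq> proj_plane R" "finite L" and d: "card L = d" using L by (auto simp: line_config_def)
  interpret linear_space L "blocks R L" by (rule linear_space_blocks[OF L'])
  note ge = harbourne_ge[OF L']
  from dv show ?thesis
    unfolding HL_abs_table_def
    using ge[of 1 0] weight_bound_2 ge[of 1 1] weight_bound_3 ge[of 3 4] weight_bound_4 ge[of 2 3] weight_bound_5 ge[of 7 12] weight_bound_6
      ge[of 1 2] weight_bound_7 weight_bound_8 ge[of 4 9] weight_bound_9 ge[of 12 29] weight_bound_10 d
    by auto
qed

lemma harbourne_lower_complex:
  assumes L: "line_config complex_field L d" and dv: "(d, v) \<in> set HL_C_table"
  shows "v \<le> harbourne_const complex_field L"
proof (cases "(d, v) \<in> set HL_abs_table")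
  case True
  then show ?thesis using harbourne_lower[OF field_complex_field L] by blast
next
  case False
  \<comment> \<open>The two tables differ only at seven and ten lines.\<close>
  then have dv': "(d, v) \<in> {(7, - 17 / 9), (10, - 34 / 15)}"
    using dv by (auto simp: HL_abs_table_def HL_C_table_def)
  have L': "L \<subseteq> proj_plane complex_field" "finite L" and d: "card L = d" using L by (auto simp: line_config_def)
  obtain w :: "(complex \<times> complex \<times> complex) set \<Rightarrow> complex \<times> complex \<times> complex"
    where "represented_space L (blocks complex_field L) w"
    using represented_space_complex[OF L'] .
  then interpret represented_space L "blocks complex_field L" w .
  show ?thesis
    using C.harbourne_ge[OF L', of 9 17] represented_weight_bound_7 C.harbourne_ge[OF L', of 15 34] represented_weight_bound_10 d dv'
    by auto
qed

text \<open>Ordered so that every initial segment of at least two lines is extremal: four lines with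
  only double points, then three lines, each through two opposite crossings of these four.\<close>

definition fano_lines :: "(nat \<times> nat \<times> nat) list" where
  "fano_lines = [(1, 0, 0), (0, 1, 0), (0, 0, 1), (1, 1, 1), (1, 1, 0), (1, 0, 1), (0, 1, 1)]"

definition fano_points :: "(nat \<times> nat \<times> nat) list" where
  "fano_points = [(0, 0, 1), (0, 1, 0), (0, 1, 1), (1, 0, 0), (1, 0, 1), (1, 1, 0), (1, 1, 1)]"

lemma fano_incidence:
  "map (\<lambda>v. filter (\<lambda>i. bil3 (zmod 2) (fano_lines ! i) v = \<zero>\<^bsub>(zmod 2)\<^esub>) [0..<length fano_lines]) fano_points
    = [[0, 1, 4], [0, 2, 5], [0, 3, 6], [1, 2, 6], [1, 3, 5], [2, 3, 4], [4, 5, 6]]"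
  unfolding fano_lines_def fano_points_def by (simp add: bil3_zmod upt_rec)

text \<open>The nine lines \<open>(a, b, 1)\<close> are those missing the point
  \<open>(0, 0, 1)\<close>, and the other twelve points are triple on them. Dropping the ninth
  leaves eight triple and four double points; the tenth line passes through three triple points and
  makes them quadruple.\<close>

definition ternary_lines :: "(nat \<times> nat \<times> nat) list" where
  "ternary_lines = [(0, 0, 1), (0, 1, 1), (0, 2, 1), (1, 0, 1), (1, 1, 1), (1, 2, 1), (2, 0, 1), (2, 1, 1), (2, 2, 1), (1, 0, 0)]"

definition ternary_points :: "(nat \<times> nat \<times> nat) list" where
  "ternary_points = [(0, 1, 0), (0, 1, 1), (0, 1, 2), (1, 0, 0), (1, 0, 1), (1, 0, 2), (1, 1, 0), (1, 1, 1), (1, 1, 2), (1, 2, 0), (1, 2, 1), (1, 2, 2)]"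

lemma ternary_incidence:
  "map (\<lambda>v. filter (\<lambda>i. bil3 (zmod 3) (ternary_lines ! i) v = \<zero>\<^bsub>(zmod 3)\<^esub>) [0..<length ternary_lines]) ternary_points
    = [[0, 3, 6, 9], [2, 5, 8, 9], [1, 4, 7, 9], [0, 1, 2], [6, 7, 8], [3, 4, 5], [0, 5, 7], [2, 4, 6], [1, 3, 8], [0, 4, 8], [1, 5, 6], [2, 3, 7]]"
  unfolding ternary_lines_def ternary_points_def by (simp add: bil3_zmod upt_rec)

text \<open>The six sides of the complete quadrangle on \<open>(1, 1, 1)\<close>,
  \<open>(1, 1, -1)\<close>, \<open>(1, -1, 1)\<close>, \<open>(-1, 1, 1)\<close>, followed by the
  join of two of its three diagonal points.\<close>

definition quadrangle_lines :: "(complex \<times> complex \<times> complex) list" where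
  "quadrangle_lines = [(1, -1, 0), (1, 1, 0), (0, 1, -1), (0, 1, 1), (1, 0, -1), (1, 0, 1), (1, 0, 0)]"

definition quadrangle_points :: "(complex \<times> complex \<times> complex) list" where
  "quadrangle_points = [(1, 1, 1), (1, 1, -1), (1, -1, 1), (-1, 1, 1), (1, 0, 0), (0, 1, 0), (0, 0, 1), (0, 1, 1), (0, 1, -1)]"

lemma quadrangle_incidence:
  "map (\<lambda>v. filter (\<lambda>i. bil3 complex_field (quadrangle_lines ! i) v = \<zero>\<^bsub>complex_field\<^esub>) [0..<length quadrangle_lines]) quadrangle_points
    = [[0, 2, 4], [0, 3, 5], [1, 3, 4], [1, 2, 5], [2, 3], [4, 5, 6], [0, 1, 6], [2, 6], [3, 6]]"
  unfolding quadrangle_lines_def quadrangle_points_def by (simp add: bil3_def upt_rec)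

text \<open>Eisenstein integers \<open>a + b \<omega>\<close> with \<open>\<omega>\<close> a primitive third root of unity.\<close>

definition eisenstein :: "int \<Rightarrow> int \<Rightarrow> complex" where
  "eisenstein a b = of_int a + of_int b * Complex (- 1 / 2) (sqrt 3 / 2)"

lemma eisenstein_add: "eisenstein a b + eisenstein c d = eisenstein (a + c) (b + d)"
  by (simp add: eisenstein_def algebra_simps)

lemma eisenstein_mult: "eisenstein a b * eisenstein c d = eisenstein (a * c - b * d) (a * d + b * c - b * d)"
  by (simp add: eisenstein_def complex_eq_iff algebra_simps)

lemma eisenstein_eq_0: "eisenstein a b = 0 \<longleftrightarrow> a = 0 \<and> b = 0"
  by (auto simp: eisenstein_def complex_eq_iff)

text \<open>The first nine lines are the factors of
  \<open>(x^3 - y^3) (y^3 - z^3) (z^3 - x^3)\<close>, the dual Hesse configuration with twelve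
  triple points; \<open>eisenstein 1 1\<close> is minus the square of the root of unity. The tenth
  line \<open>x = 0\<close> joins two of the triple points and creates three double points.\<close>

definition hesse_lines :: "(complex \<times> complex \<times> complex) list" where
  "hesse_lines = [(eisenstein 1 0, eisenstein (-1) 0, eisenstein 0 0), (eisenstein 1 0, eisenstein 0 (-1), eisenstein 0 0), (eisenstein 1 0, eisenstein 1 1, eisenstein 0 0), (eisenstein 0 0, eisenstein 1 0, eisenstein (-1) 0), (eisenstein 0 0, eisenstein 1 0, eisenstein 0 (-1)), (eisenstein 0 0, eisenstein 1 0, eisenstein 1 1), (eisenstein (-1) 0, eisenstein 0 0, eisenstein 1 0), (eisenstein 0 (-1), eisenstein 0 0, eisenstein 1 0), (eisenstein 1 1, eisenstein 0 0, eisenstein 1 0), (eisenstein 1 0, eisenstein 0 0, eisenstein 0 0)]"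

definition hesse_points :: "(complex \<times> complex \<times> complex) list" where
  "hesse_points = [(eisenstein 1 0, eisenstein 0 0, eisenstein 0 0), (eisenstein 0 0, eisenstein 1 0, eisenstein 0 0), (eisenstein 0 0, eisenstein 0 0, eisenstein 1 0), (eisenstein 1 0, eisenstein 1 0, eisenstein 1 0), (eisenstein 1 0, eisenstein 1 0, eisenstein 0 1), (eisenstein 1 0, eisenstein 1 0, eisenstein (-1) (-1)), (eisenstein 1 0, eisenstein 0 1, eisenstein 1 0), (eisenstein 1 0, eisenstein 0 1, eisenstein 0 1), (eisenstein 1 0, eisenstein 0 1, eisenstein (-1) (-1)), (eisenstein 1 0, eisenstein (-1) (-1), eisenstein 1 0), (eisenstein 1 0, eisenstein (-1) (-1), eisenstein 0 1), (eisenstein 1 0, eisenstein (-1) (-1), eisenstein (-1) (-1)), (eisenstein 0 0, eisenstein 1 0, eisenstein 1 0), (eisenstein 0 0, eisenstein 0 1, eisenstein 1 0), (eisenstein 0 0, eisenstein (-1) (-1), eisenstein 1 0)]"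

lemma hesse_incidence:
  "map (\<lambda>v. filter (\<lambda>i. bil3 complex_field (hesse_lines ! i) v = \<zero>\<^bsub>complex_field\<^esub>) [0..<length hesse_lines]) hesse_points
    = [[3, 4, 5], [6, 7, 8, 9], [0, 1, 2, 9], [0, 3, 6], [0, 5, 7], [0, 4, 8], [2, 4, 6], [2, 3, 7], [2, 5, 8], [1, 5, 6], [1, 4, 7], [1, 3, 8], [3, 9], [4, 9], [5, 9]]"
  unfolding hesse_lines_def hesse_points_def by (simp add: bil3_def eisenstein_add eisenstein_mult eisenstein_eq_0 upt_rec)

lemma abs_attained:
  assumes "(d, v) \<in> set HL_abs_table"
  shows "\<exists>R :: nat ring. field R \<and> (\<exists>L. line_config R L d \<and> harbourne_const R L = v)"
proof -
  interpret F2: field "zmod 2" by (rule field_zmod) simp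
  interpret F3: field "zmod 3" by (rule field_zmod) simp
  have nz: "\<forall>u\<in>set fano_lines. nzvec (zmod 2) u" "\<forall>u\<in>set fano_points. nzvec (zmod 2) u"
    "\<forall>u\<in>set ternary_lines. nzvec (zmod 3) u" "\<forall>u\<in>set ternary_points. nzvec (zmod 3) u"
    by (auto simp: nzvec_def fano_lines_def fano_points_def ternary_lines_def ternary_points_def)
  have len: "length fano_lines = 7" "length ternary_lines = 10"
    by (simp_all add: fano_lines_def ternary_lines_def)
  note f = F2.realize_prefix[OF fano_incidence nz(1,2) _ refl refl]
  note t = F3.realize_prefix[OF ternary_incidence nz(3,4) _ refl refl]
  have 2: "\<exists>L. line_config (zmod 2) L 2 \<and> harbourne_const (zmod 2) L = 0"
    using f[of 2] by (simp add: len upt_rec)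
  have 3: "\<exists>L. line_config (zmod 2) L 3 \<and> harbourne_const (zmod 2) L = - 1"
    using f[of 3] by (simp add: len upt_rec)
  have 4: "\<exists>L. line_config (zmod 2) L 4 \<and> harbourne_const (zmod 2) L = - 4 / 3"
    using f[of 4] by (simp add: len upt_rec)
  have 5: "\<exists>L. line_config (zmod 2) L 5 \<and> harbourne_const (zmod 2) L = - 3 / 2"
    using f[of 5] by (simp add: len upt_rec)
  have 6: "\<exists>L. line_config (zmod 2) L 6 \<and> harbourne_const (zmod 2) L = - 12 / 7"
    using f[of 6] by (simp add: len upt_rec)
  have 7: "\<exists>L. line_config (zmod 2) L 7 \<and> harbourne_const (zmod 2) L = - 2"
    using f[of 7] by (simp add: len upt_rec)
  have 8: "\<exists>L. line_config (zmod 3) L 8 \<and> harbourne_const (zmod 3) L = - 2"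
    using t[of 8] by (simp add: len upt_rec)
  have 9: "\<exists>L. line_config (zmod 3) L 9 \<and> harbourne_const (zmod 3) L = - 9 / 4"
    using t[of 9] by (simp add: len upt_rec)
  have 10: "\<exists>L. line_config (zmod 3) L 10 \<and> harbourne_const (zmod 3) L = - 29 / 12"
    using t[of 10] by (simp add: len upt_rec)
  show ?thesis
    using assms 2 3 4 5 6 7 8 9 10 F2.field_axioms F3.field_axioms unfolding HL_abs_table_def by auto
qed

lemma complex_attained:
  assumes "(d, v) \<in> set HL_C_table"
  shows "\<exists>L. line_config complex_field L d \<and> harbourne_const complex_field L = v"
proof -
  have nz: "\<forall>u\<in>set quadrangle_lines. nzvec complex_field u" "\<forall>u\<in>set quadrangle_points. nzvec complex_field u"
    "\<forall>u\<in>set hesse_lines. nzvec complex_field u" "\<forall>u\<in>set hesse_points. nzvec complex_field u"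
    by (auto simp: nzvec_def quadrangle_lines_def quadrangle_points_def hesse_lines_def hesse_points_def eisenstein_eq_0)
  have len: "length quadrangle_lines = 7" "length hesse_lines = 10"
    by (simp_all add: quadrangle_lines_def hesse_lines_def)
  note q = C.realize_prefix[OF quadrangle_incidence nz(1,2) _ refl refl]
  note h = C.realize_prefix[OF hesse_incidence nz(3,4) _ refl refl]
  have 2: "\<exists>L. line_config complex_field L 2 \<and> harbourne_const complex_field L = 0"
    using q[of 2] by (simp add: len upt_rec)
  have 3: "\<exists>L. line_config complex_field L 3 \<and> harbourne_const complex_field L = - 1"
    using q[of 3] by (simp add: len upt_rec)
  have 4: "\<exists>L. line_config complex_field L 4 \<and> harbourne_const complex_field L = - 4 / 3"
    using q[of 4] by (simp add: len upt_rec)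
  have 5: "\<exists>L. line_config complex_field L 5 \<and> harbourne_const complex_field L = - 3 / 2"
    using q[of 5] by (simp add: len upt_rec)
  have 6: "\<exists>L. line_config complex_field L 6 \<and> harbourne_const complex_field L = - 12 / 7"
    using q[of 6] by (simp add: len upt_rec)
  have 7: "\<exists>L. line_config complex_field L 7 \<and> harbourne_const complex_field L = - 17 / 9"
    using q[of 7] by (simp add: len upt_rec)
  have 8: "\<exists>L. line_config complex_field L 8 \<and> harbourne_const complex_field L = - 2"
    using h[of 8] by (simp add: len upt_rec)
  have 9: "\<exists>L. line_config complex_field L 9 \<and> harbourne_const complex_field L = - 9 / 4"
    using h[of 9] by (simp add: len upt_rec)
  have 10: "\<exists>L. line_config complex_field L 10 \<and> harbourne_const complex_field L = - 34 / 15"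
    using h[of 10] by (simp add: len upt_rec)
  show ?thesis
    using assms 2 3 4 5 6 7 8 9 10 unfolding HL_C_table_def by auto
qed

theorem theorem2:
  shows "(\<forall>(d, v) \<in> set HL_abs_table.
            (\<forall>(R :: ('a, 'b) ring_scheme) L. field R \<longrightarrow> line_config R L d \<longrightarrow> v \<le> harbourne_const R L)
          \<and> (\<exists>(R :: nat ring). field R \<and> HL_min_is R d v))
       \<and> (\<forall>(d, v) \<in> set HL_C_table. HL_min_is complex_field d v)"
proof (intro conjI ballI; clarify)
  fix d v assume dv: "(d, v) \<in> set HL_abs_table"
  obtain R :: "nat ring" and L where R: "field R" "line_config R L d" "harbourne_const R L = v"
    using abs_attained[OF dv] by blast
  have "HL_min_is R d v"
    unfolding HL_min_is_def using R(2,3) harbourne_lower[OF R(1) _ dv] by blast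
  \<comment> \<open>The lower bound is polymorphic: it was just used for the witness over
    \<open>nat\<close> and is used here for an arbitrary ring type. Together these express a minimum
    over all fields.\<close>
  moreover have "v \<le> harbourne_const R' L'" if "field R'" "line_config R' L' d" for R' :: "('a, 'b) ring_scheme" and L'
    by (rule harbourne_lower[OF that dv])
  ultimately show "(\<forall>(R :: ('a, 'b) ring_scheme) L. field R \<longrightarrow> line_config R L d \<longrightarrow> v \<le> harbourne_const R L)
      \<and> (\<exists>(R :: nat ring). field R \<and> HL_min_is R d v)"
    using R(1) by blast
next
  fix d v assume "(d, v) \<in> set HL_C_table"
  then show "HL_min_is complex_field d v"
    using complex_attained harbourne_lower_complex unfolding HL_min_is_def by blast
qed

end
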